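(* Let $k\ge4$ be an even integer, let ${\rm M}=[\frac{k}{6}]$, and for $1\le m\le {\rm M}$ let $t_m=\frac12\cot(\frac{m\pi}{k+1})$. Then $t_1>\cdots>t_{\rm M}>\frac{\sqrt3}{2}$. For each integer $m$ with $1\le m\le {\rm M}-1$, ${\rm E}_k'$ has a unique zero in the set $\{\frac12+it : t_{m+1}<t<t_m\}$. Moreover, when $k\equiv4\bmod 6$ and $k\ne4$, ${\rm E}_k'$ has a unique zero in the set $\{\frac12+it : \frac{\sqrt3}{2}<t<t_{\rm M}\}$.
   Context: For even $k\ge4$, ${\rm E}_k(z)=1-\frac{2k}{{\rm B}_k}\sum_{n\ge1}\sigma_{k-1}(n)q^n$, $q=e^{2\pi i z}$, $z$ in the upper half-plane, is the normalized Eisenstein series of weight $k$ for ${\bf SL}_2({\bf Z})$ (${\rm B}_k$ Bernoulli number, $\sigma_{k-1}(n)=\sum_{d\mid n}d^{k-1}$), and ${\rm E}_k'$ is its derivative in $z$. $[x]$ is the largest integer $\le x$. *)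

theory Defs
  imports "HOL-Complex_Analysis.Complex_Analysis"
begin

text \<open>
  The Bernoulli numbers, read off from the exponential generating function
  $x / (e^x - 1) = \sum_n B_n x^n / n!$, so that $B_1 = -1/2$.
\<close>
definition bernoulli :: "nat \<Rightarrow> real" where
  "bernoulli n = fact n * fps_nth (fps_X / (fps_exp 1 - 1)) n"

definition divisor_sigma :: "nat \<Rightarrow> nat \<Rightarrow> nat" where
  "divisor_sigma s n = (\<Sum>d | d dvd n. d ^ s)"

text \<open>
  The series runs over $n \geq 1$, whence the shift by \<^const>\<open>Suc\<close>. The function is
  meaningful only on the upper half-plane; elsewhere its values are unspecified. As the upper
  half-plane is open, \<^const>\<open>deriv\<close> at a point of it is unaffected by the values outside.
\<close>
definition eisenstein_E :: "nat \<Rightarrow> complex \<Rightarrow> complex" where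
  "eisenstein_E k z =
     1 - of_real (2 * real k / bernoulli k) *
       (\<Sum>n. of_nat (divisor_sigma (k - 1) (Suc n)) * exp (2 * of_real pi * \<i> * z) ^ Suc n)"

definition cot_height :: "nat \<Rightarrow> nat \<Rightarrow> real" where
  "cot_height k m = 1 / 2 * cot (real m * pi / real (k + 1))"

definition segment_re_half :: "real \<Rightarrow> real \<Rightarrow> complex set" where
  "segment_re_half a b = {1 / 2 + \<i> * of_real t | t :: real. a < t \<and> t < b}"

end

theory Submission
  imports Defs "HOL-Real_Asymp.Real_Asymp"
begin

text \<open>
  On the line \<open>Re z = 1/2\<close> the derivative of \<open>E\<^sub>k\<close> is, up to a non-zero constant, the real
  function \<open>F t = (\<Sum>n. (-1)^n * n * \<sigma>\<^sub>k\<^sub>-\<^sub>1(n) * exp (-2 * pi * n * t))\<close>. The coefficients are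
  so close to \<open>n^k\<close> that by Lipschitz' formula, with \<open>w = t - \<i>/2 = r * exp (-\<i> * \<phi>)\<close>, the
  function \<open>F\<close> is proportional to \<open>Re (w powi -(k+1)) = r powi -(k+1) * cos ((k+1) * \<phi>)\<close> up to an
  error of at most \<open>7/10 * r powi -(k+1)\<close>, provided that \<open>r\<^sup>2\<close> is at most \<open>(k+1)/3.4\<close>. The point \<open>t\<^sub>m\<close> corresponds
  to \<open>(k+1) * \<phi> = m * pi\<close>, so the sign of \<open>F\<close> there is \<open>(-1)^m\<close>; and a bound for a Wronskian shows
  that the quotient of \<open>F\<close> by \<open>Im (w powi -(k+1))\<close> is strictly increasing between two such points.
  For larger \<open>t\<close>, that is for \<open>m\<^sup>2 < (k+1)/11\<close>, the series itself is dominated by its \<open>m\<close>-th term at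
  \<open>t\<^sub>m\<close> and by the terms of index \<open>m\<close> and \<open>m+1\<close> between \<open>t\<^sub>m\<^sub>+\<^sub>1\<close> and \<open>t\<^sub>m\<close>, where
  \<open>exp (2 * pi * (m + 1/20) * t) * F t\<close> is strictly monotone.
\<close>

section \<open>Bernoulli numbers\<close>

text \<open>The two methods cover each other's failures. In the lattice sum the next points have
  squared modulus \<open>r^2 + 2\<close>, hence relative weight about
  \<open>exp (-(k+1) / r^2)\<close>, which is harmless only while \<open>r^2\<close> is small
  against k. In the Fourier series the logarithms of the terms form a nearly concave sequence with
  curvature about \<open>k / n^2\<close> at its peak, so one or two terms dominate only while
  \<open>m^2\<close> is small against k. At the m-th node r is about
  \<open>(k+1) / (2 * pi * m)\<close>, so \<open>r^2 \<le> (k+1) / 3.4\<close> reads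
  \<open>m^2 \<ge> 0.0861 * (k+1)\<close>, and 1/11 lies just above this constant.

  Zeros exist because signs alternate. For uniqueness, F is of no direct use, since already its main
  term is not monotone between two nodes. F is therefore multiplied by a function without zeros
  there that makes the product monotone. In the lattice region this function is
  \<open>1 / Im W\<close>: the zeros of \<open>Im W\<close> are exactly the points where
  \<open>(k+1) * \<phi>\<close> is a multiple of pi, that is the nodes, so the quotient is regular
  on each open interval between them.\<close>

lemma bernoulli_fps_convolution:
  fixes g :: "real fps"
  assumes "g = fps_X / (fps_exp 1 - 1)"
  shows "fps_X * fps_deriv g = g - g * g - fps_X * g" and "fps_nth g 0 = 1"
proof -
  have sd: "subdegree (fps_exp 1 - 1 :: real fps) = 1"
    by (rule subdegreeI) auto
  have ne: "(fps_exp 1 - 1 :: real fps) \<noteq> 0"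
    using sd by force
  have g: "g * (fps_exp 1 - 1) = fps_X"
    unfolding assms by (rule fps_times_divide_eq[OF ne]) (unfold sd, simp)
  have "fps_nth (g * (fps_exp 1 - 1)) 1 = fps_nth g 0"
    by (simp add: fps_mult_nth)
  then show "fps_nth g 0 = 1"
    by (simp add: g)
  have "fps_deriv (g * (fps_exp 1 - 1)) = 1"
    by (simp add: g)
  then have "fps_deriv g * (fps_exp 1 - 1) + g * fps_exp 1 = 1"
    by (simp add: algebra_simps)
  then have "g * (fps_deriv g * (fps_exp 1 - 1) + g * fps_exp 1) = g"
    by simp
  then have "fps_deriv g * (g * (fps_exp 1 - 1)) + g * (g * (fps_exp 1 - 1)) + g * g = g"
    by (simp add: algebra_simps)
  then have "fps_deriv g * fps_X + g * fps_X + g * g = g"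
    by (simp only: g)
  then show "fps_X * fps_deriv g = g - g * g - fps_X * g"
    by (simp add: algebra_simps)
qed

text \<open>Euler's quadratic recurrence, read off from the Riccati equation for the generating
  function. Unlike the linear recurrence it makes the signs visible. The indices 0, 1, n-1, n carry
  the values with \<open>b 0\<close> and \<open>b 1\<close> and are split off; they produce the
  factor n+1.\<close>

lemma bernoulli_recurrence:
  defines "b \<equiv> \<lambda>n. bernoulli n / fact n"
  shows "b 0 = 1" and "b 1 = - 1 / 2" and "b 2 = 1 / 12"
    and "n \<ge> 3 \<Longrightarrow> (real n + 1) * b n = - (\<Sum>i=2..n-2. b i * b (n - i))"
proof -
  define g :: "real fps" where "g = fps_X / (fps_exp 1 - 1)"
  note G = bernoulli_fps_convolution[OF g_def]
  have b: "b n = fps_nth g n" for n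
    by (simp add: b_def bernoulli_def g_def)
  have rec: "real (Suc n) * b (Suc n) = b (Suc n) - (\<Sum>i\<le>Suc n. b i * b (Suc n - i)) - b n" for n
    using arg_cong[OF G(1), of "\<lambda>f. fps_nth f (Suc n)"]
    by (simp only: fps_sub_nth fps_X_mult_nth) (simp add: b fps_mult_nth atLeast0AtMost)
  show b0: "b 0 = 1"
    using G(2) by (simp add: b)
  show b1: "b 1 = - 1 / 2"
    using rec[of 0] b0 by (simp add: numeral_2_eq_2)
  show "b 2 = 1 / 12"
    using rec[of 1] b0 b1 by (simp add: numeral_2_eq_2)
  assume n: "n \<ge> 3"
  have "{..n} = {0, 1, n - 1, n} \<union> {2..n-2}"
    using n by auto
  then have "(\<Sum>i\<le>n. b i * b (n - i)) =
      (\<Sum>i\<in>{0, 1, n - 1, n}. b i * b (n - i)) + (\<Sum>i=2..n-2. b i * b (n - i))"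
    using n by (simp only:) (rule sum.union_disjoint, auto)
  also have "(\<Sum>i\<in>{0, 1, n - 1, n}. b i * b (n - i)) = 2 * b n - b (n - 1)"
    using n b0 b1 by simp
  finally show "(real n + 1) * b n = - (\<Sum>i=2..n-2. b i * b (n - i))"
    using rec[of "n - 1"] n by (simp add: algebra_simps)
qed

lemma bernoulli_odd_eq_0: "odd n \<Longrightarrow> n \<ge> 3 \<Longrightarrow> bernoulli n = 0"
proof (induction n rule: less_induct)
  case (less n)
  have "bernoulli i * bernoulli (n - i) = 0" if "i \<in> {2..n-2}" for i
  proof (cases "odd i")
    case True
    then have "i \<noteq> 2" by auto
    with True less.IH[of i] that less.prems show ?thesis by auto
  next
    case False
    then have odd: "odd (n - i)" using less.prems that by auto
    then have "n - i \<noteq> 2" by (metis even_numeral)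
    then have "n - i \<ge> 3" using that less.prems unfolding atLeastAtMost_iff by arith
    with odd less.IH[of "n - i"] that less.prems show ?thesis by auto
  qed
  then have "(real n + 1) * (bernoulli n / fact n) = 0"
    using bernoulli_recurrence(4)[OF less.prems(2)] by (simp add: sum.neutral)
  then show ?case by simp
qed

text \<open>By induction all products of two even-index terms in the quadratic recurrence have the
  same sign, and the odd-index ones vanish, so nothing cancels. What is needed later is
  \<open>bernoulli k \<noteq> 0\<close>: a vanishing denominator would make the factor in
  \<open>eisenstein_E\<close> equal to 0 and its derivative zero everywhere.\<close>

lemma bernoulli_even_sign: "n \<ge> 1 \<Longrightarrow> (-1) ^ n * bernoulli (2 * n) < 0"
proof (induction n rule: less_induct)
  case (less n)
  define b where "b = (\<lambda>n. bernoulli n / fact n)"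
  show ?case
  proof (cases "n = 1")
    case True
    then show ?thesis
      using bernoulli_recurrence(3) by simp
  next
    case False
    let ?S = "\<Sum>i=2..2*n-2. (-1) ^ n * (b i * b (2 * n - i))"
    have pos: "(-1) ^ n * (b i * b (2 * n - i)) \<ge> 0" if i: "i \<in> {2..2*n-2}" for i
    proof (cases "odd i")
      case True
      then have "i \<noteq> 2" by auto
      then show ?thesis
        using True i bernoulli_odd_eq_0[of i] by (auto simp: b_def)
    next
      case False
      then obtain j where j: "i = 2 * j" by (auto elim: evenE)
      have jn: "1 \<le> j" "j < n" using i j less.prems by auto
      then have "(-1) ^ j * b (2 * j) < 0" "(-1) ^ (n - j) * b (2 * (n - j)) < 0"
        using less.IH[of j] less.IH[of "n - j"]
        by (auto simp: b_def zero_less_divide_iff divide_less_0_iff mult_less_0_iff)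
      then have "0 < ((-1) ^ j * b (2 * j)) * ((-1) ^ (n - j) * b (2 * (n - j)))"
        by (rule mult_neg_neg)
      also have "\<dots> = ((-1) ^ j * (-1) ^ (n - j)) * (b i * b (2 * n - i))"
        by (simp add: j algebra_simps)
      also have "(-1 :: real) ^ j * (-1) ^ (n - j) = (-1) ^ n"
        using jn by (simp flip: power_add)
      finally show ?thesis by simp
    qed
    \<comment> \<open>The summand i = 2 alone supplies strict positivity; the others are only known
      to be non-negative.\<close>
    have "(-1) ^ (n - 1) * b (2 * n - 2) < 0"
      using less.IH[of "n - 1"] False less.prems
      by (simp add: b_def right_diff_distrib' mult_less_0_iff divide_less_0_iff zero_less_divide_iff)
    moreover have "(-1 :: real) ^ n = - ((-1) ^ (n - 1))"
      using less.prems by (cases n) auto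
    moreover have "b 2 = 1 / 12"
      using bernoulli_recurrence(3) by (simp add: b_def)
    ultimately have "(-1) ^ (n - 1) * b (2 * n - 2) < 0"
        "(-1) ^ n * (b 2 * b (2 * n - 2)) = - ((-1) ^ (n - 1) * b (2 * n - 2)) / 12"
      by simp_all
    then have "0 < (-1) ^ n * (b 2 * b (2 * n - 2))"
      by linarith
    also have "\<dots> \<le> ?S"
      using False less.prems by (intro member_le_sum pos) auto
    also have "?S = (-1) ^ n * (\<Sum>i=2..2*n-2. b i * b (2 * n - i))"
      by (simp add: sum_distrib_left)
    also have "(\<Sum>i=2..2*n-2. b i * b (2 * n - i)) = - ((real (2 * n) + 1) * b (2 * n))"
      using bernoulli_recurrence(4)[of "2 * n"] False less.prems by (simp add: b_def)
    finally show ?thesis 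
      by (simp add: b_def mult_less_0_iff zero_less_mult_iff divide_less_0_iff zero_less_divide_iff)
  qed
qed

section \<open>Divisor sums\<close>

text \<open>The operator q d/dq multiplies the n-th coefficient of the Eisenstein series by n, so
  these are the coefficients of its derivative up to a constant. They are comparable with
  \<open>n ^ k\<close>.\<close>

definition sigma_coeff :: "nat \<Rightarrow> nat \<Rightarrow> real" where
  "sigma_coeff k n = real n * real (divisor_sigma (k - 1) n)"

text \<open>Every number divides 0, and a sum over an infinite set is 0 by convention. This default
  value lets all series below start at index 0, although the series in \<open>eisenstein_E\<close>
  starts at 1.\<close>

lemma divisor_sigma_0_right [simp]: "divisor_sigma s 0 = 0"
  by (simp add: divisor_sigma_def)

lemma sigma_coeff_0 [simp]: "sigma_coeff k 0 = 0"
  by (simp add: sigma_coeff_def)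

lemma sum_inverse_squares_bound: "(\<Sum>d=3..n. 1 / (real d)\<^sup>2) \<le> 1 / 2"
proof -
  have "(\<Sum>d=3..n. 1 / (real d)\<^sup>2) \<le> 1 / 2 - 1 / real n" if "n \<ge> 2" for n
    using that
  proof (induction n rule: dec_induct)
    case base
    then show ?case by simp
  next
    case (step n)
    have "1 / (real (Suc n))\<^sup>2 \<le> 1 / (real n * real (Suc n))"
      unfolding power2_eq_square using step by (intro divide_left_mono mult_right_mono) auto
    also have "\<dots> = 1 / real n - 1 / real (Suc n)"
      using step by (simp add: divide_simps)
    finally have "1 / (real (Suc n))\<^sup>2 \<le> 1 / real n - 1 / real (Suc n)" .
    then show ?case
      using step by simp
  qed
  note * = this[of n]
  show ?thesis
  proof (cases "n \<ge> 2")
    case True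
    have "1 / real n \<ge> 0" by simp
    with *[OF True] show ?thesis by linarith
  qed simp
qed

text \<open>Passing to complementary divisors gives \<open>n ^ k\<close> times the sum of
  \<open>d ^ -(k-1)\<close> over the divisors d. The divisor 1 gives the lower bound and 2 the error
  \<open>(1/2) ^ (k-1)\<close>. All d from 3 on together cost at most 1/8 of that error: two factors
  2/d are kept for summability, the other k-3 are at most \<open>(2/3) ^ 7\<close>, and
  \<open>4 * (2/3) ^ 7 \<le> 1/4\<close>.\<close>

lemma sigma_coeff_bounds:
  assumes "k \<ge> 10"
  shows "real n ^ k \<le> sigma_coeff k n"
    and "sigma_coeff k n \<le> (1 + 9 / 8 * (1 / 2) ^ (k - 1)) * real n ^ k"
proof -
  consider "n = 0" | "n \<ge> 1" by linarith
  then have "real n ^ k \<le> sigma_coeff k n \<and>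
      sigma_coeff k n \<le> (1 + 9 / 8 * (1 / 2) ^ (k - 1)) * real n ^ k"
  proof cases
    case 1
    then show ?thesis using assms by (simp add: power_0_left)
  next
    case n: 2
    define s where "s = (\<Sum>d | d dvd n. (1 / real d) ^ (k - 1))"
    have fin: "finite {d. d dvd n}" using n by simp
    have k: "k = Suc (k - 1)" using assms by simp
    have bij: "bij_betw (\<lambda>d. n div d) {d. d dvd n} {d. d dvd n}"
      by (rule bij_betw_byWitness[where f' = "\<lambda>d. n div d"]) (use n in auto)
    have "sigma_coeff k n = real n * (\<Sum>d | d dvd n. real (n div d) ^ (k - 1))"
      unfolding sigma_coeff_def divisor_sigma_def
      using sum.reindex_bij_betw[OF bij, of "\<lambda>d. real d ^ (k - 1)"] by simp
    also have "(\<Sum>d | d dvd n. real (n div d) ^ (k - 1)) = real n ^ (k - 1) * s"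
      unfolding s_def sum_distrib_left
      by (intro sum.cong) (auto simp: real_of_nat_div power_divide)
    also have "real n * (real n ^ (k - 1) * s) = real n ^ k * s"
      by (subst (2) k) simp
    finally have eq: "sigma_coeff k n = real n ^ k * s" .
    have "(1 / real 1) ^ (k - 1) \<le> s"
      unfolding s_def by (rule member_le_sum) (use fin in auto)
    then have s1: "1 \<le> s" by simp
    have "s \<le> (\<Sum>d\<in>{1, 2} \<union> {3..n}. (1 / real d) ^ (k - 1))"
      unfolding s_def by (rule sum_mono2) (use n in \<open>auto dest: dvd_imp_le intro: Suc_leI\<close>)
    also have "\<dots> = 1 + (1 / 2) ^ (k - 1) + (\<Sum>d=3..n. (1 / real d) ^ (k - 1))"
      by (subst sum.union_disjoint) auto
    also have "(\<Sum>d=3..n. (1 / real d) ^ (k - 1)) \<le>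
        (\<Sum>d=3..n. (1 / 2) ^ (k - 1) * (1 / 4) * (1 / (real d)\<^sup>2))"
    proof (rule sum_mono)
      fix d assume d: "d \<in> {3..n}"
      have "k - 1 = (k - 3) + 2"
        using assms by simp
      then have "(2 / real d) ^ (k - 1) = (2 / real d) ^ (k - 3) * (2 / real d)\<^sup>2"
        by (simp only: power_add)
      also have "(2 / real d) ^ (k - 3) \<le> (2 / 3) ^ (k - 3)"
        using d by (intro power_mono) (auto simp: field_simps)
      also have "(2 / 3 :: real) ^ (k - 3) \<le> (2 / 3) ^ 7"
        using assms by (intro power_decreasing) auto
      finally have "(2 / real d) ^ (k - 1) \<le> (2 / 3) ^ 7 * (2 / real d)\<^sup>2"
        by (simp add: mult_right_mono)
      also have "\<dots> \<le> 1 / 4 * (1 / (real d)\<^sup>2)"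
        by (simp add: power_divide power2_eq_square divide_simps)
      finally have *: "(2 / real d) ^ (k - 1) \<le> 1 / 4 * (1 / (real d)\<^sup>2)" .
      have "(1 / real d) ^ (k - 1) = (1 / 2) ^ (k - 1) * (2 / real d) ^ (k - 1)"
        by (simp flip: power_mult_distrib)
      also have "\<dots> \<le> (1 / 2) ^ (k - 1) * (1 / 4 * (1 / (real d)\<^sup>2))"
        by (intro mult_left_mono *) simp
      finally show "(1 / real d) ^ (k - 1) \<le> (1 / 2) ^ (k - 1) * (1 / 4) * (1 / (real d)\<^sup>2)"
        by (simp only: mult.assoc)
    qed
    also have "\<dots> = (1 / 2) ^ (k - 1) * (1 / 4) * (\<Sum>d=3..n. 1 / (real d)\<^sup>2)"
      by (rule sum_distrib_left[symmetric])
    also have "\<dots> \<le> (1 / 2) ^ (k - 1) * (1 / 4) * (1 / 2)"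
      by (rule mult_left_mono[OF sum_inverse_squares_bound]) simp
    finally have s2: "s \<le> 1 + 9 / 8 * (1 / 2) ^ (k - 1)" by simp
    show ?thesis unfolding eq
      using mult_left_mono[OF s1, of "real n ^ k"] mult_left_mono[OF s2, of "real n ^ k"]
      by (simp add: mult.commute)
  qed
  then show "real n ^ k \<le> sigma_coeff k n"
    and "sigma_coeff k n \<le> (1 + 9 / 8 * (1 / 2) ^ (k - 1)) * real n ^ k" by auto
qed

section \<open>The Lipschitz formula\<close>

text \<open>Stated for \<open>x * D\<close> because x d/dx keeps all exponents and multiplies
  \<open>c n\<close> by n. It can thus be iterated without index shifts.\<close>

lemma powser_log_deriv:
  fixes c :: "nat \<Rightarrow> 'a::{real_normed_field,banach}"
  assumes sm: "\<And>x. norm x < 1 \<Longrightarrow> summable (\<lambda>n. c n * x ^ n)" and x: "norm x < 1"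
  shows "summable (\<lambda>n. of_nat n * c n * x ^ n)"
    and "\<exists>D. ((\<lambda>x. \<Sum>n. c n * x ^ n) has_field_derivative D) (at x) \<and>
             x * D = (\<Sum>n. of_nat n * c n * x ^ n)"
proof -
  have "summable (\<lambda>n. diffs c n * x ^ n)"
    by (rule termdiff_converges[OF x sm])
  then have "(\<lambda>n. x * (diffs c n * x ^ n)) sums (x * (\<Sum>n. diffs c n * x ^ n))"
    by (intro sums_mult summable_sums)
  also have "(\<lambda>n. x * (diffs c n * x ^ n)) = (\<lambda>n. of_nat (Suc n) * c (Suc n) * x ^ Suc n)"
    by (simp add: diffs_def fun_eq_iff mult_ac)
  finally have *: "(\<lambda>n. of_nat n * c n * x ^ n) sums (x * (\<Sum>n. diffs c n * x ^ n))"
    by (subst (asm) sums_Suc_iff) simp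
  then show "summable (\<lambda>n. of_nat n * c n * x ^ n)"
    by (rule sums_summable)
  show "\<exists>D. ((\<lambda>x. \<Sum>n. c n * x ^ n) has_field_derivative D) (at x) \<and>
             x * D = (\<Sum>n. of_nat n * c n * x ^ n)"
    using termdiffs_strong'[OF sm x] sums_unique[OF *] by blast
qed

lemma summable_nat_power_powser:
  fixes x :: "'a::{real_normed_field,banach}"
  assumes "norm x < 1"
  shows "summable (\<lambda>n. of_nat n ^ p * x ^ n)"
  using assms
proof (induction p arbitrary: x)
  case 0
  then show ?case by (simp add: summable_geometric)
next
  case (Suc p)
  from powser_log_deriv(1)[OF Suc.IH Suc.prems] show ?case
    by (simp add: mult.assoc)
qed

lemma norm_cexp_2pi_i_less_1: "Im z > 0 \<Longrightarrow> norm (exp (2 * of_real pi * \<i> * z)) < 1"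
  by (simp add: norm_exp_eq_Re)

lemma cot_q_expansion:
  assumes "Im z > 0"
  shows "Digamma (1 - z) - Digamma z =
    of_real pi * \<i> - 2 * of_real pi * \<i> * (\<Sum>n. exp (2 * of_real pi * \<i> * z) ^ n)"
proof -
  define q where "q = exp (2 * of_real pi * \<i> * z)"
  define u where "u = exp (\<i> * (of_real pi * z))"
  have u: "u \<noteq> 0" and q: "q = u ^ 2"
    by (simp_all add: u_def q_def flip: exp_double) (simp add: mult_ac)
  have nq: "norm q < 1"
    using norm_cexp_2pi_i_less_1[OF assms] by (simp add: q_def)
  then have q1: "q \<noteq> 1" by auto
  have nonint: "z \<notin> \<int>\<^sub>\<le>\<^sub>0" "1 - z \<notin> \<int>\<^sub>\<le>\<^sub>0"
    using assms by (auto elim!: nonpos_Ints_cases simp: complex_eq_iff)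
  have "((\<lambda>z. rGamma z * rGamma (1 - z)) has_field_derivative
      rGamma z * rGamma (1 - z) * (Digamma (1 - z) - Digamma z)) (at z)"
    using nonint by (auto intro!: derivative_eq_intros simp: algebra_simps)
  moreover have "((\<lambda>z. sin (of_real pi * z) / of_real pi) has_field_derivative
      cos (of_real pi * z)) (at z)"
    by (auto intro!: derivative_eq_intros)
  ultimately have "rGamma z * rGamma (1 - z) * (Digamma (1 - z) - Digamma z) = cos (of_real pi * z)"
    unfolding rGamma_reflection_complex by (rule DERIV_unique)
  then have D: "sin (of_real pi * z) * (Digamma (1 - z) - Digamma z) = of_real pi * cos (of_real pi * z)"
    unfolding rGamma_reflection_complex by (simp add: field_simps)
  have sc: "sin (of_real pi * z) = (u - 1 / u) / (2 * \<i>)" "cos (of_real pi * z) = (u + 1 / u) / 2"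
    unfolding sin_exp_eq cos_exp_eq u_def by (simp_all add: exp_minus inverse_eq_divide)
  have D2: "(a / (2 * \<i>)) * X = p * (b / 2) \<Longrightarrow> a * X = p * \<i> * b" for a b p X :: complex
    by (drule arg_cong[of _ _ "\<lambda>w. 2 * \<i> * w"]) (simp add: mult_ac)
  have "(u - 1 / u) * (Digamma (1 - z) - Digamma z) = of_real pi * \<i> * (u + 1 / u)"
    by (rule D2[OF D[unfolded sc]])
  then have "(u * (u - 1 / u)) * (Digamma (1 - z) - Digamma z) = of_real pi * \<i> * (u * (u + 1 / u))"
    by simp
  moreover have "u * (u - 1 / u) = q - 1" "u * (u + 1 / u) = q + 1"
    using u by (simp_all add: q algebra_simps power2_eq_square)
  ultimately have "(q - 1) * (Digamma (1 - z) - Digamma z) = of_real pi * \<i> * (q + 1)"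
    by simp
  then have "Digamma (1 - z) - Digamma z = of_real pi * \<i> * (q + 1) / (q - 1)"
    using q1 by (simp add: field_simps)
  also have "\<dots> = of_real pi * \<i> - 2 * of_real pi * \<i> * (1 / (1 - q))"
    using q1 by (simp add: divide_simps) (simp add: algebra_simps)
  also have "1 / (1 - q) = (\<Sum>n. q ^ n)"
    using suminf_geometric[OF nq] by simp
  finally show ?thesis by (simp add: q_def)
qed

text \<open>Lipschitz' formula, since \<open>Polygamma\<close> is itself a sum over the points z +
  j. Each differentiation raises the order and multiplies the n-th coefficient by
  \<open>2 * pi * \<i> * n\<close>; the inner derivative of 1 - z accounts for the alternating
  sign.\<close>

lemma Polygamma_q_expansion:
  assumes "Im z > 0"
  shows "(-1) ^ Suc k * Polygamma (Suc k) (1 - z) - Polygamma (Suc k) z =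
    - ((2 * of_real pi * \<i>) ^ Suc (Suc k)) *
      (\<Sum>n. of_nat n ^ Suc k * exp (2 * of_real pi * \<i> * z) ^ n)"
  using assms
proof (induction k arbitrary: z)
  let ?q = "\<lambda>z. exp (2 * of_real pi * \<i> * z)"
  let ?P = "\<lambda>p q. \<Sum>n. of_nat n ^ p * q ^ n :: complex"
  have nonint: "z \<notin> \<int>\<^sub>\<le>\<^sub>0" "1 - z \<notin> \<int>\<^sub>\<le>\<^sub>0" if "Im z > 0" for z
    using that by (auto elim!: nonpos_Ints_cases simp: complex_eq_iff)
  have dP: "((\<lambda>z. ?P p (?q z)) has_field_derivative 2 * of_real pi * \<i> * ?P (Suc p) (?q z)) (at z)"
    if z: "Im z > 0" for p z
  proof -
    from powser_log_deriv(2)[OF summable_nat_power_powser norm_cexp_2pi_i_less_1[OF z], of p]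
    obtain D where D: "(?P p has_field_derivative D) (at (?q z))" "?q z * D = ?P (Suc p) (?q z)"
      by (auto simp: mult.assoc)
    have "(?q has_field_derivative (?q z * (2 * of_real pi * \<i>))) (at z)"
      by (auto intro!: derivative_eq_intros)
    from DERIV_chain2[OF D(1) this] show ?thesis
      unfolding D(2)[symmetric] by (simp add: mult_ac)
  qed
  have dG: "((\<lambda>z. c * Polygamma p (1 - z) - Polygamma p z) has_field_derivative
      (- c * Polygamma (Suc p) (1 - z) - Polygamma (Suc p) z)) (at z)" if "Im z > 0" for c p z
    using nonint[OF that] by (auto intro!: derivative_eq_intros)
  have uniq: "D1 = D2" if "Im z > 0" "\<And>z. Im z > 0 \<Longrightarrow> f z = g z"
     "(f has_field_derivative D1) (at z)" "(g has_field_derivative D2) (at z)"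
   for f g :: "complex \<Rightarrow> complex" and D1 D2 z
  proof -
    have "\<forall>\<^sub>F w in nhds z. Im w > 0"
      using that(1) open_halfspace_Im_gt[of 0] by (metis eventually_nhds mem_Collect_eq)
    then have "\<forall>\<^sub>F w in nhds z. f w = g w"
      by eventually_elim (rule that(2))
    then have "(g has_field_derivative D1) (at z)"
      using DERIV_cong_ev[of z z f g D1 D1] that(3) by simp
    then show ?thesis using that(4) by (rule DERIV_unique)
  qed
  {
    case 0
    have "((\<lambda>z. of_real pi * \<i> - 2 * of_real pi * \<i> * ?P 0 (?q z)) has_field_derivative
       - (2 * of_real pi * \<i>) * (2 * of_real pi * \<i> * ?P (Suc 0) (?q z))) (at z)"
      by (rule DERIV_cong, rule DERIV_diff[OF DERIV_const DERIV_cmult[OF dP[OF 0]]]) simp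
    from uniq[OF 0 _ dG[OF 0, of 1 0] this] cot_q_expansion
    show ?case by (simp add: power2_eq_square mult_ac)
  next
    case (Suc k)
    have "((\<lambda>z. - ((2 * of_real pi * \<i>) ^ Suc (Suc k)) * ?P (Suc k) (?q z)) has_field_derivative
       - ((2 * of_real pi * \<i>) ^ Suc (Suc k)) * (2 * of_real pi * \<i> * ?P (Suc (Suc k)) (?q z))) (at z)"
      by (rule DERIV_cmult dP Suc)+
    from uniq[OF Suc.prems Suc.IH dG[OF Suc.prems] this]
    show ?case by (simp add: mult_ac)
  }
qed

lemma Polygamma_Suc:
  "Polygamma (Suc k) z = (-1) ^ k * fact (k + 1) * (\<Sum>j. inverse ((z + of_nat j) ^ (k + 2)))"
  by (simp add: Polygamma_def)

text \<open>The formula at z = 1/2 + it, where q = \<open>- exp (- 2 * pi * t)\<close>. The points z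
  + j and 1 - z + j are \<open>\<i>\<close> and \<open>- \<i>\<close> times conjugate numbers, so
  the two halves of the lattice fold into twice a real part.\<close>

lemma alternating_lipschitz:
  fixes t :: real and k :: nat
  assumes t: "t > 0"
  defines "V \<equiv> \<lambda>j. inverse (Complex t (- (real j + 1 / 2)) ^ (k + 2))"
  shows "summable (\<lambda>j. Re (V j))"
    and "(\<Sum>m. real m ^ (k + 1) * (- exp (- 2 * pi * t)) ^ m) =
      2 * fact (k + 1) / (2 * pi) ^ (k + 2) * (\<Sum>j. Re (V j))"
proof -
  define z where "z = Complex (1 / 2) t"
  define x where "x = exp (- 2 * pi * t)"
  have z: "Im z > 0" and z0: "z \<noteq> 0" "1 - z \<noteq> 0"
    using t by (auto simp: z_def complex_eq_iff)
  have zj: "inverse ((z + of_nat j) ^ (k + 2)) = inverse (\<i> ^ (k + 2)) * V j"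
    "inverse ((1 - z + of_nat j) ^ (k + 2)) = \<i> ^ (k + 2) * cnj (V j)" for j
  proof -
    have "z + of_nat j = \<i> * Complex t (- (real j + 1 / 2))"
      by (simp add: z_def complex_eq_iff)
    then show "inverse ((z + of_nat j) ^ (k + 2)) = inverse (\<i> ^ (k + 2)) * V j"
      by (simp only: power_mult_distrib inverse_mult_distrib V_def)
    have "1 - z + of_nat j = inverse \<i> * cnj (Complex t (- (real j + 1 / 2)))"
      by (simp add: z_def complex_eq_iff)
    then show "inverse ((1 - z + of_nat j) ^ (k + 2)) = \<i> ^ (k + 2) * cnj (V j)"
      by (simp only: power_mult_distrib inverse_mult_distrib V_def power_inverse
          complex_cnj_inverse complex_cnj_power inverse_inverse_eq)
  qed
  have "summable (\<lambda>j. inverse (\<i> ^ (k + 2)) * V j)"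
    unfolding zj(1)[symmetric] by (rule Polygamma_converges'[OF z0(1)]) simp
  then have sV: "summable V"
    by (subst (asm) summable_cmult_iff) simp
  then show "summable (\<lambda>j. Re (V j))"
    by (rule summable_Re)
  have cV: "(\<lambda>j. cnj (V j)) sums cnj (suminf V)"
    unfolding sums_cnj using sV by (rule summable_sums)
  have x: "exp (2 * of_real pi * \<i> * z) = of_real (- x)"
    by (simp add: z_def x_def exp_eq_polar complex_eq_iff Re_exp Im_exp)
  have nx: "norm (- x) < 1"
    using t by (simp add: x_def)
  have S: "(\<Sum>n. of_nat n ^ (k + 1) * complex_of_real (- x) ^ n) =
      of_real (\<Sum>n. real n ^ (k + 1) * (- x) ^ n)"
    using suminf_of_real[OF summable_nat_power_powser[OF nx, of "k + 1"], where 'a = complex] by simp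
  have "(-1 :: complex) ^ k = \<i> ^ k * \<i> ^ k"
    by (simp flip: power_mult_distrib)
  then have ii: "(-1) ^ k * inverse (\<i> ^ (k + 2)) = - (\<i> ^ k)"
    by (simp add: field_simps)
  have "(-1) ^ Suc k * Polygamma (Suc k) (1 - z) - Polygamma (Suc k) z =
     fact (k + 1) * (- (\<i> ^ (k + 2)) * (\<Sum>j. cnj (V j)) - (-1) ^ k * (inverse (\<i> ^ (k + 2)) * (\<Sum>j. V j)))"
  proof -
    have "(\<Sum>j. inverse (\<i> ^ (k + 2)) * V j) = inverse (\<i> ^ (k + 2)) * (\<Sum>j. V j)"
      "(\<Sum>j. \<i> ^ (k + 2) * cnj (V j)) = \<i> ^ (k + 2) * (\<Sum>j. cnj (V j))"
      by (rule suminf_mult[OF sV], rule suminf_mult[OF cV[THEN sums_summable]])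
    moreover have "(-1 :: complex) ^ k * (-1) ^ k = 1"
      by (simp flip: power_mult_distrib)
    then have "(-1 :: complex) ^ Suc k * ((-1) ^ k * f * (w * a)) - (-1) ^ k * f * b =
        f * (- w * a - (-1) ^ k * b)" for a b f w
      by (simp add: algebra_simps)
    ultimately show ?thesis
      unfolding Polygamma_Suc zj by (simp only:)
  qed
  also have "\<dots> = fact (k + 1) * (\<i> ^ k * ((\<Sum>j. cnj (V j)) + (\<Sum>j. V j)))"
  proof -
    have "- (\<i> ^ (k + 2)) * a - (-1) ^ k * (inverse (\<i> ^ (k + 2)) * b) = \<i> ^ k * (a + b)" for a b
      unfolding mult.assoc[symmetric] ii by (simp add: distrib_left)
    then show ?thesis by (simp only:)
  qed
  also have "(\<Sum>j. cnj (V j)) + (\<Sum>j. V j) = of_real (2 * (\<Sum>j. Re (V j)))"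
    unfolding sums_unique[OF cV, symmetric] sums_unique[OF sums_Re[OF summable_sums[OF sV]], symmetric]
    by (simp add: complex_add_cnj add.commute)
  finally have "- ((2 * of_real pi * \<i>) ^ (k + 2)) * complex_of_real (\<Sum>n. real n ^ (k + 1) * (- x) ^ n) =
     fact (k + 1) * (\<i> ^ k * of_real (2 * (\<Sum>j. Re (V j))))"
    using Polygamma_q_expansion[OF z, of k] unfolding x S[symmetric]
    by (simp only: Suc_eq_plus1 add.assoc one_add_one)
  moreover have "- ((2 * of_real pi * \<i>) ^ (k + 2)) * a = \<i> ^ k * (of_real ((2 * pi) ^ (k + 2)) * a)" for a
    by (simp add: power_mult_distrib)
  ultimately have "\<i> ^ k * (of_real ((2 * pi) ^ (k + 2)) * complex_of_real (\<Sum>n. real n ^ (k + 1) * (- x) ^ n)) =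
     \<i> ^ k * (fact (k + 1) * of_real (2 * (\<Sum>j. Re (V j))))"
    by (simp only: mult.left_commute)
  then have "complex_of_real ((2 * pi) ^ (k + 2) * (\<Sum>n. real n ^ (k + 1) * (- x) ^ n)) =
     of_real (fact (k + 1) * (2 * (\<Sum>j. Re (V j))))"
    by (simp del: of_nat_Suc)
  then have eq: "(2 * pi) ^ (k + 2) * (\<Sum>n. real n ^ (k + 1) * (- x) ^ n) =
     fact (k + 1) * (2 * (\<Sum>j. Re (V j)))"
    by (subst (asm) of_real_eq_iff)
  have solve: "L = 2 * F / A * R" if "A \<noteq> 0" "A * L = F * (2 * R)" for A L F R :: real
    using that by (simp add: field_simps)
  show "(\<Sum>m. real m ^ (k + 1) * (- exp (- 2 * pi * t)) ^ m) =
      2 * fact (k + 1) / (2 * pi) ^ (k + 2) * (\<Sum>j. Re (V j))"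
    by (rule solve[OF _ eq[unfolded x_def]]) simp
qed

text \<open>The formula at z = it, where all terms of the series are positive. The lattice point it
  gives the main term; for the others Bernoulli's inequality yields
  \<open>(1 + j^2/t^2) ^ h \<ge> h * j^2/t^2\<close>, and twice the sum \<open>pi^2 / 6\<close>
  gives the correction.\<close>

lemma lipschitz_sum_bound:
  fixes t :: real
  assumes t: "t > 0" and h: "h \<ge> 1" "2 * h \<le> k + 2"
  shows "(\<Sum>m. real m ^ (k + 1) * exp (- 2 * pi * t) ^ m) \<le>
      fact (k + 1) / (2 * pi) ^ (k + 2) * ((1 + pi\<^sup>2 * t\<^sup>2 / (3 * real h)) / t ^ (k + 2))"
proof -
  define z where "z = Complex 0 t"
  define x where "x = exp (- 2 * pi * t)"
  define B where "B = (\<lambda>j. t\<^sup>2 / (real h * (real j + 1)\<^sup>2) / t ^ (k + 2))"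
  have z: "Im z > 0" and z0: "z \<noteq> 0" "1 - z \<noteq> 0"
    using t by (auto simp: z_def complex_eq_iff)
  have B: "B sums (t\<^sup>2 / real h / t ^ (k + 2) * (pi\<^sup>2 / 6))"
  proof -
    have "B = (\<lambda>j. t\<^sup>2 / real h / t ^ (k + 2) * (1 / (real j + 1)\<^sup>2))"
      by (simp add: B_def fun_eq_iff mult_ac)
    then show ?thesis
      using sums_mult[OF inverse_squares_sums, of "t\<^sup>2 / real h / t ^ (k + 2)"]
      by (simp add: add.commute)
  qed
  have bnd: "inverse (norm w ^ (k + 2)) \<le> B j" if "norm w ^ 2 = t ^ 2 + (real j + 1) ^ 2" for w :: complex and j
  proof -
    define u where "u = (real j + 1) ^ 2 / t ^ 2"
    have nw: "norm w ^ 2 = t ^ 2 * (1 + u)" and u: "u \<ge> 0"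
      using that t by (simp_all add: u_def field_simps)
    have "norm w = sqrt (norm w ^ 2)"
      by simp
    also have "\<dots> = t * sqrt (1 + u)"
      unfolding nw real_sqrt_mult using t by simp
    finally have w: "norm w = t * sqrt (1 + u)" .
    have "real h * u \<le> 1 + real h * u"
      by simp
    also have "\<dots> \<le> (1 + u) ^ h"
      by (rule Bernoulli_inequality) (use u in auto)
    also have "\<dots> = sqrt (1 + u) ^ (2 * h)"
      using u by (simp add: power_mult)
    also have "\<dots> \<le> sqrt (1 + u) ^ (k + 2)"
      by (rule power_increasing) (use u h in auto)
    finally have "real h * u * t ^ (k + 2) \<le> norm w ^ (k + 2)"
      unfolding w power_mult_distrib using t by (simp add: mult.commute)
    moreover have "0 < real h * u * t ^ (k + 2)"
      using t h by (simp add: u_def)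
    ultimately have "inverse (norm w ^ (k + 2)) \<le> inverse (real h * u * t ^ (k + 2))"
      by (intro le_imp_inverse_le)
    also have "\<dots> = B j"
      using t by (simp add: B_def u_def divide_simps)
    finally show ?thesis .
  qed
  have S1: "norm (\<Sum>j. inverse ((1 - z + of_nat j) ^ (k + 2))) \<le> suminf B"
  proof (rule norm_suminf_le)
    show "norm (inverse ((1 - z + of_nat j) ^ (k + 2))) \<le> B j" for j
      unfolding norm_inverse norm_power by (rule bnd) (simp add: cmod_power2 z_def add.commute)
  qed (use B in \<open>simp add: sums_iff\<close>)
  have sm: "summable (\<lambda>j. inverse ((z + of_nat j) ^ (k + 2)))"
    by (rule Polygamma_converges'[OF z0(1)]) simp
  have "norm (\<Sum>j. inverse ((z + of_nat (Suc j)) ^ (k + 2))) \<le> suminf B"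
  proof (rule norm_suminf_le)
    show "norm (inverse ((z + of_nat (Suc j)) ^ (k + 2))) \<le> B j" for j
      unfolding norm_inverse norm_power by (rule bnd) (simp add: cmod_power2 z_def add.commute)
  qed (use B in \<open>simp add: sums_iff\<close>)
  moreover have "norm (inverse (z ^ (k + 2))) = 1 / t ^ (k + 2)"
    unfolding norm_inverse norm_power using t by (simp add: z_def cmod_def inverse_eq_divide)
  ultimately have S2: "norm (\<Sum>j. inverse ((z + of_nat j) ^ (k + 2))) \<le> 1 / t ^ (k + 2) + suminf B"
    using suminf_split_head[OF sm] norm_triangle_ineq[of "inverse (z ^ (k + 2))"
      "\<Sum>j. inverse ((z + of_nat (Suc j)) ^ (k + 2))"] by simp
  have x: "exp (2 * of_real pi * \<i> * z) = of_real x"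
    by (simp add: z_def x_def complex_eq_iff Re_exp Im_exp)
  have nx: "norm x < 1"
    using t by (simp add: x_def)
  have S: "(\<Sum>n. of_nat n ^ (k + 1) * complex_of_real x ^ n) =
      of_real (\<Sum>n. real n ^ (k + 1) * x ^ n)"
    using suminf_of_real[OF summable_nat_power_powser[OF nx, of "k + 1"], where 'a = complex] by simp
  have S0: "(\<Sum>n. real n ^ (k + 1) * x ^ n) \<ge> 0"
    by (intro suminf_nonneg summable_nat_power_powser nx) (simp add: x_def)
  have "(2 * pi) ^ (k + 2) * (\<Sum>n. real n ^ (k + 1) * x ^ n) =
     norm (- ((2 * of_real pi * \<i>) ^ Suc (Suc k)) * (\<Sum>n. of_nat n ^ Suc k * complex_of_real x ^ n))"
    using S S0 by (simp add: norm_mult norm_power)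
  also have "\<dots> = norm ((-1) ^ Suc k * Polygamma (Suc k) (1 - z) - Polygamma (Suc k) z)"
    by (simp only: Polygamma_q_expansion[OF z] x)
  also have "\<dots> \<le> norm (Polygamma (Suc k) (1 - z)) + norm (Polygamma (Suc k) z)"
    by (rule order_trans[OF norm_triangle_ineq4]) (simp add: norm_mult norm_power)
  also have "\<dots> = fact (k + 1) * (norm (\<Sum>j. inverse ((1 - z + of_nat j) ^ (k + 2))) +
      norm (\<Sum>j. inverse ((z + of_nat j) ^ (k + 2))))"
    unfolding Polygamma_Suc norm_mult norm_fact by (simp add: norm_power distrib_left)
  also have "\<dots> \<le> fact (k + 1) * (suminf B + (1 / t ^ (k + 2) + suminf B))"
    by (intro mult_left_mono add_mono S1 S2) simp
  also have "suminf B + (1 / t ^ (k + 2) + suminf B) = (1 + pi\<^sup>2 * t\<^sup>2 / (3 * real h)) / t ^ (k + 2)"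
    using B by (simp add: sums_iff add_divide_distrib)
  finally have "(\<Sum>n. real n ^ (k + 1) * x ^ n) \<le>
      fact (k + 1) * ((1 + pi\<^sup>2 * t\<^sup>2 / (3 * real h)) / t ^ (k + 2)) / (2 * pi) ^ (k + 2)"
    by (subst pos_le_divide_eq) (simp_all only: mult.commute zero_less_power zero_less_mult_iff pi_gt_zero, simp)
  then show ?thesis
    by (simp only: x_def times_divide_eq_left)
qed

section \<open>Bounds for the lattice sum\<close>

lemma one_plus_over_power_mono:
  fixes y :: real
  assumes "y \<ge> 0" "1 \<le> m" "m \<le> n"
  shows "(1 + y / real m) ^ m \<le> (1 + y / real n) ^ n"
  using assms(3)
proof (induction n rule: dec_induct)
  case base
  then show ?case by simp
next
  case (step n)
  then have n: "real n > 0" using assms by simp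
  define a where "a = 1 + y / real n"
  define b where "b = 1 + y / real (Suc n)"
  have a: "a > 0" and b: "b > 0"
    using n assms by (auto simp: a_def b_def add_pos_nonneg)
  have "b / a - 1 = - (y / (real (Suc n) * (real n + y)))"
    using n assms(1) unfolding a_def b_def by (simp add: divide_simps) (simp add: algebra_simps)
  then have eq: "real (Suc n) * (b / a - 1) = - (y / (real n + y))"
    by simp
  have "1 / a = 1 - y / (real n + y)"
    using n assms(1) by (simp add: a_def divide_simps)
  also have "\<dots> = 1 + real (Suc n) * (b / a - 1)"
    by (simp only: eq)
  also have "\<dots> \<le> (1 + (b / a - 1)) ^ Suc n"
  proof (rule Bernoulli_inequality)
    have "b / a > 0" using a b by simp
    then show "- 1 \<le> b / a - 1" by linarith
  qed
  also have "\<dots> = b ^ Suc n / a ^ Suc n"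
    by (simp add: power_divide)
  finally have "a ^ n \<le> b ^ Suc n"
    using a by (simp add: field_simps)
  then show ?case
    using step.IH by (simp add: a_def b_def)
qed

text \<open>
  For \<open>3.4 * r\<^sup>2 \<le> 2 * h + 1\<close> one has \<open>s / r\<^sup>2 \<ge> y / h\<close> with \<open>y / 5 = 0.309 * s\<close>, because
  \<open>3.4 * h / (2 * h + 1) \<ge> 17 / 11\<close> for \<open>h \<ge> 5\<close>; and \<open>(1 + y / h) ^ h\<close> increases with \<open>h\<close>. This is
  where the denominator comes from. The numerator bounds the loss in the Wronskian.
\<close>
definition lattice_majorant :: "nat \<Rightarrow> real" where
  "lattice_majorant j =
     (3 * real (Suc j) + 5 / 2) / (1 + 309 / 1000 * (real (Suc j) * real (Suc (Suc j)))) ^ 5"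

lemma lattice_majorant_Suc:
  "lattice_majorant (Suc j) \<le> 7 / 10 * (1 / (real (j + 2) * real (j + 3)) - 1 / (real (j + 3) * real (j + 4)))"
proof -
  define x where "x = real j + 2"
  define s where "s = x * (x + 1)"
  have x: "x \<ge> 2" by (simp add: x_def)
  then have s: "s \<ge> 3 * x" "s \<ge> 6"
    using mult_mono[of 2 x 3 "x + 1"] by (auto simp: s_def)
  have "(3 * x + 5 / 2) * (x + 2) = 3 * s + 11 / 2 * x + 5"
    by (simp add: s_def field_simps)
  also have "\<dots> \<le> 57 / 10 * s"
    using s by simp
  finally have "(3 * x + 5 / 2) * (x + 2) * s \<le> 57 / 10 * s * s"
    using s by (intro mult_right_mono) auto
  \<comment> \<open>With a = 0.309 * s, the inequality \<open>(1 + a)^2 \<ge> 4 * a\<close> is used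
    for four of the five factors, and 1 + a is at least 2.854 because s is at least 6.\<close>
  also have "\<dots> \<le> 14 / 10 * ((1236 / 1000 * s)\<^sup>2 * (2854 / 1000))"
    using s by (simp add: power2_eq_square)
  also have "\<dots> \<le> 14 / 10 * (((1 + 309 / 1000 * s)\<^sup>2)\<^sup>2 * (1 + 309 / 1000 * s))"
  proof (intro mult_left_mono mult_mono power_mono)
    show "1236 / 1000 * s \<le> (1 + 309 / 1000 * s)\<^sup>2"
      using zero_le_power2[of "1 - 309 / 1000 * s"] by (simp add: power2_eq_square algebra_simps)
  qed (use s in auto)
  also have "\<dots> = 14 / 10 * (1 + 309 / 1000 * s) ^ 5"
    by (simp add: eval_nat_numeral)
  finally have le: "(3 * x + 5 / 2) * (x + 2) * s \<le> 14 / 10 * (1 + 309 / 1000 * s) ^ 5" .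
  have cross: "a / d \<le> c / (e * s)" if "a * e * s \<le> c * d" "0 < d" "0 < e" for a c d e :: real
    using that s by (simp add: divide_simps mult_ac)
  have "(3 * x + 5 / 2) / (1 + 309 / 1000 * s) ^ 5 \<le> 14 / 10 / ((x + 2) * s)"
    by (rule cross[OF le]) (use s x in auto)
  also have "14 / 10 / ((x + 2) * s) = 7 / 10 * (1 / (x * (x + 1)) - 1 / ((x + 1) * (x + 2)))"
    using x by (simp add: s_def divide_simps)
  finally show ?thesis
    by (simp add: lattice_majorant_def x_def s_def add.commute)
qed

text \<open>The first term, below 0.497, carries most of the sum; the others telescope to at most
  7/60. The value 0.62 leaves room for the coefficient error both in the value bound and in the
  Wronskian.\<close>

lemma lattice_majorant_sum: "summable lattice_majorant" "suminf lattice_majorant \<le> 62 / 100"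
proof -
  let ?g = "\<lambda>j. 7 / 10 * (1 / (real (j + 2) * real (j + 3)) - 1 / (real (j + 3) * real (j + 4)))"
  have "(\<lambda>j. 1 / (real (j + 2) * real (j + 3))) \<longlonglongrightarrow> 0"
    by real_asymp
  from telescope_sums'[OF this]
  have g: "?g sums (7 / 10 * (1 / 6))"
    by (intro sums_mult) (simp add: algebra_simps)
  have pos: "lattice_majorant j \<ge> 0" for j
    by (auto simp: lattice_majorant_def intro!: divide_nonneg_nonneg)
  have sS: "summable (\<lambda>j. lattice_majorant (Suc j))"
    by (rule summable_comparison_test'[of ?g 0])
       (use g lattice_majorant_Suc pos in \<open>auto simp: sums_iff\<close>)
  then show s: "summable lattice_majorant"
    by (simp add: summable_Suc_iff)
  have "suminf (\<lambda>j. lattice_majorant (Suc j)) \<le> 7 / 10 * (1 / 6)"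
    using suminf_le[OF lattice_majorant_Suc sS] g by (simp add: sums_iff)
  moreover have "lattice_majorant 0 \<le> 497 / 1000"
    by (simp add: lattice_majorant_def eval_nat_numeral)
  ultimately show "suminf lattice_majorant \<le> 62 / 100"
    using suminf_split_head[OF s] by simp
qed

lemma cmod_lattice_point:
  fixes t :: real
  shows "(cmod (Complex t (- (real j + 1 / 2))))\<^sup>2 = t\<^sup>2 + 1 / 4 + real j * (real j + 1)"
  unfolding cmod_power2 by (simp add: power2_eq_square algebra_simps)

lemma lattice_ratio_bound:
  fixes t r :: real and h :: nat
  assumes r: "r > 0" "r\<^sup>2 = t\<^sup>2 + 1 / 4" "34 / 10 * r\<^sup>2 \<le> real (2 * h + 1)" and h: "h \<ge> 5"
    and v: "v\<^sup>2 = r\<^sup>2 + s" "v > 0" "s \<ge> 0"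
  shows "(1 + 309 / 1000 * s) ^ 5 * r ^ (2 * h + 1) \<le> v ^ (2 * h + 1)"
proof -
  define y where "y = 1545 / 1000 * s"
  have "y / real h \<le> s / r\<^sup>2"
  proof -
    have "1545 / 1000 * r\<^sup>2 \<le> real h"
      using r h by simp
    then have "1545 / 1000 * r\<^sup>2 * s \<le> real h * s"
      using v by (intro mult_right_mono)
    moreover have "r\<^sup>2 > 0" "real h > 0"
      using r(1) h by auto
    ultimately show ?thesis
      by (simp add: y_def divide_simps mult_ac)
  qed
  have "(1 + 309 / 1000 * s) ^ 5 = (1 + y / real 5) ^ 5"
    by (simp add: y_def)
  also have "\<dots> \<le> (1 + y / real h) ^ h"
    by (rule one_plus_over_power_mono) (use v h in \<open>auto simp: y_def\<close>)
  also have "\<dots> \<le> (1 + s / r\<^sup>2) ^ h"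
    using \<open>y / real h \<le> s / r\<^sup>2\<close> v by (intro power_mono) (auto simp: y_def)
  also have "1 + s / r\<^sup>2 = (v / r)\<^sup>2"
    unfolding power_divide v(1) using r(1) by (simp add: add_divide_distrib)
  also have "((v / r)\<^sup>2) ^ h \<le> (v / r) ^ (2 * h + 1)"
  proof -
    have "r \<le> v"
      by (rule power2_le_imp_le) (use v in auto)
    then have "1 \<le> v / r" using r by simp
    then have "(v / r) ^ (2 * h) \<le> (v / r) ^ (2 * h + 1)"
      by (intro power_increasing) auto
    then show ?thesis by (simp only: power_mult)
  qed
  finally show ?thesis
    using r by (simp add: power_divide pos_le_divide_eq del: power_Suc)
qed

lemma lattice_term_bound:
  fixes t r :: real and h j :: nat
  assumes "r > 0" "r\<^sup>2 = t\<^sup>2 + 1 / 4" "34 / 10 * r\<^sup>2 \<le> real (2 * h + 1)" "h \<ge> 5"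
  shows "r ^ (2 * h + 1) * norm (inverse (Complex t (- (real (Suc j) + 1 / 2)) ^ (2 * h + 1))) *
     (3 * real (Suc j) + 5 / 2) \<le> lattice_majorant j"
proof -
  define v where "v = norm (Complex t (- (real (Suc j) + 1 / 2)))"
  define s where "s = real (Suc j) * real (Suc (Suc j))"
  have v2: "v\<^sup>2 = r\<^sup>2 + s"
    unfolding v_def cmod_lattice_point assms(2) by (simp add: s_def algebra_simps)
  have s: "s > 0" by (simp add: s_def)
  have "v\<^sup>2 > 0"
    unfolding v2 using s assms(1) by (simp add: add_pos_pos)
  then have "v \<noteq> 0" by auto
  then have v: "v > 0" by (simp add: v_def)
  have "(1 + 309 / 1000 * s) ^ 5 * r ^ (2 * h + 1) \<le> v ^ (2 * h + 1)"
    by (rule lattice_ratio_bound[OF assms v2 v]) (use s in simp)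
  then have "r ^ (2 * h + 1) / v ^ (2 * h + 1) \<le> 1 / (1 + 309 / 1000 * s) ^ 5"
    using v s by (simp add: divide_simps mult_ac del: power_Suc power_mult power_add)
  then have "r ^ (2 * h + 1) / v ^ (2 * h + 1) * (3 * real (Suc j) + 5 / 2) \<le>
      1 / (1 + 309 / 1000 * s) ^ 5 * (3 * real (Suc j) + 5 / 2)"
    by (rule mult_right_mono) simp
  moreover have "norm (inverse (Complex t (- (real (Suc j) + 1 / 2)) ^ (2 * h + 1))) = 1 / v ^ (2 * h + 1)"
    unfolding norm_inverse norm_power v_def by (rule inverse_eq_divide)
  ultimately show ?thesis
    by (simp only: lattice_majorant_def s_def times_divide_eq_left times_divide_eq_right
        mult_1_left mult_1_right)
qed

text \<open>The expression is \<open>Im (cnj (W / w) * W)\<close>, that is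
  \<open>(norm W)^2 * Im w / (norm w)^2\<close>. The phase of W drops out, so the sign is constant
  because \<open>Im w = -1/2\<close>.\<close>

lemma wronskian_lattice_main:
  fixes w :: complex
  assumes "w = Complex t (- 1 / 2)" "w \<noteq> 0"
  shows "Re (W / w) * Im W - Re W * Im (W / w) = - ((norm W)\<^sup>2 / (2 * (norm w)\<^sup>2))"
proof -
  define N where "N = (Re w)\<^sup>2 + (Im w)\<^sup>2"
  have "N > 0"
    using assms(2) by (simp add: N_def complex_neq_0)
  moreover have re: "Re w = t" "Im w = - 1 / 2"
    by (simp_all add: assms(1))
  ultimately show ?thesis
    unfolding Re_divide Im_divide cmod_power2 N_def[symmetric] unfolding re
    by (simp add: field_simps power2_eq_square)
qed

text \<open>Separately the two products, scaled by \<open>2 * r^2\<close>, are of size t, which is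
  not controlled by a. Their leading parts cancel up to the factor \<open>1 - \<theta>\<close>, and
  \<open>2 * t * (1 - \<theta>) \<le> a\<close> follows from
  \<open>2 * t * a \<le> t^2 + a^2\<close>. Hence the bound is uniform in t.\<close>

lemma wronskian_lattice_term:
  fixes v w V W :: complex and t a r R :: real
  assumes t: "t \<ge> 0" "a \<ge> 1 / 2" and v: "v = Complex t (- a)" and w: "w = Complex t (- 1 / 2)"
    and r: "r = norm w" "r > 0"
  shows "2 * r\<^sup>2 * \<bar>Re (V / v) * Im W - Re V * Im (W / w)\<bar> \<le> norm V * norm W * (3 * a + 1)"
proof -
  define R where "R = norm v"
  have r2: "r\<^sup>2 = t\<^sup>2 + 1 / 4" and R2: "R\<^sup>2 = t\<^sup>2 + a\<^sup>2"
    unfolding r R_def v w cmod_power2 by (simp_all add: power2_eq_square)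
  have rR: "r\<^sup>2 \<le> R\<^sup>2"
    unfolding r2 R2 using power_mono[of "1/2" a 2] t by (simp add: power2_eq_square)
  have r0: "r\<^sup>2 > 0" and R0: "R\<^sup>2 > 0"
    using r rR by (auto intro: less_le_trans)
  define \<theta> where "\<theta> = r\<^sup>2 / R\<^sup>2"
  have th: "0 \<le> \<theta>" "\<theta> \<le> 1"
    using r0 R0 rR by (auto simp: \<theta>_def)
  have Vv: "r\<^sup>2 * Re (V / v) = \<theta> * (t * Re V - a * Im V)"
    unfolding \<theta>_def using R0 r0 by (simp add: Re_divide v R2 field_simps)
  have Ww: "r\<^sup>2 * Im (W / w) = t * Im W + Re W / 2"
    unfolding r(1) cmod_power2 using r0[unfolded r2] by (simp add: Im_divide w r2 field_simps)
  have "2 * r\<^sup>2 * (Re (V / v) * Im W - Re V * Im (W / w)) =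
      2 * (r\<^sup>2 * Re (V / v)) * Im W - 2 * Re V * (r\<^sup>2 * Im (W / w))"
    by (simp add: algebra_simps)
  also have "\<dots> = - (2 * t * (1 - \<theta>)) * (Re V * Im W) - 2 * a * \<theta> * (Im V * Im W) - Re V * Re W"
    unfolding Vv Ww by (simp add: algebra_simps)
  also have "\<bar>\<dots>\<bar> \<le> 2 * t * (1 - \<theta>) * (norm V * norm W) + 2 * a * \<theta> * (norm V * norm W) + norm V * norm W"
  proof -
    have 1: "\<bar>Re V * Im W\<bar> \<le> norm V * norm W" "\<bar>Im V * Im W\<bar> \<le> norm V * norm W"
      "\<bar>Re V * Re W\<bar> \<le> norm V * norm W"
      unfolding abs_mult by (intro mult_mono abs_Re_le_cmod abs_Im_le_cmod; simp)+
    have "\<bar>- (2 * t * (1 - \<theta>)) * (Re V * Im W)\<bar> \<le> 2 * t * (1 - \<theta>) * (norm V * norm W)"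
      using mult_left_mono[OF 1(1), of "2 * t * (1 - \<theta>)"] t th by (simp add: abs_mult)
    moreover have "\<bar>2 * a * \<theta> * (Im V * Im W)\<bar> \<le> 2 * a * \<theta> * (norm V * norm W)"
      using mult_left_mono[OF 1(2), of "2 * a * \<theta>"] t th by (simp add: abs_mult)
    ultimately show ?thesis using 1(3) by linarith
  qed
  also have "\<dots> = norm V * norm W * (2 * t * (1 - \<theta>) + 2 * a * \<theta> + 1)"
    by (simp add: algebra_simps)
  also have "\<dots> \<le> norm V * norm W * (3 * a + 1)"
  proof (intro mult_left_mono)
    have "2 * t * (1 - \<theta>) = 2 * t * (a\<^sup>2 - 1 / 4) / R\<^sup>2"
      using R0 by (simp add: \<theta>_def r2 R2 divide_simps) (simp add: algebra_simps)
    also have "\<dots> \<le> a"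
    proof -
      have "2 * t * a \<le> R\<^sup>2"
        unfolding R2 using zero_le_power2[of "t - a"] by (simp add: power2_eq_square algebra_simps)
      then have "2 * t * a * a \<le> R\<^sup>2 * a"
        using t by (intro mult_right_mono) auto
      moreover have "2 * t * (a\<^sup>2 - 1 / 4) = 2 * t * a * a - t / 2"
        by (simp add: power2_eq_square algebra_simps)
      ultimately have "2 * t * (a\<^sup>2 - 1 / 4) \<le> a * R\<^sup>2"
        using t by (simp only: mult.commute[of a "R\<^sup>2"])
      then show ?thesis using R0 by (simp add: pos_divide_le_eq)
    qed
    finally have "2 * t * (1 - \<theta>) \<le> a" .
    moreover have "2 * a * \<theta> \<le> 2 * a"
      using t th mult_left_mono[of \<theta> 1 "2 * a"] by simp
    ultimately show "2 * t * (1 - \<theta>) + 2 * a * \<theta> + 1 \<le> 3 * a + 1" by simp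
  qed simp
  finally show ?thesis
    using r0 by (simp add: abs_mult)
qed

section \<open>Power series in - exp (-2 pi t), the value of q on the line, and their lattice
  expansion\<close>

definition qsum :: "(nat \<Rightarrow> real) \<Rightarrow> real \<Rightarrow> real" where
  "qsum c t = (\<Sum>m. c m * (- exp (- 2 * pi * t)) ^ m)"

lemma summable_poly_bounded_powser:
  fixes c :: "nat \<Rightarrow> real" and x :: real
  assumes c: "\<And>m. \<bar>c m\<bar> \<le> C * real m ^ p" and x: "\<bar>x\<bar> < 1"
  shows "summable (\<lambda>m. c m * x ^ m)"
proof (rule summable_comparison_test')
  show "summable (\<lambda>m. C * (real m ^ p * \<bar>x\<bar> ^ m))"
    by (intro summable_mult summable_nat_power_powser) (use x in simp)
  show "norm (c m * x ^ m) \<le> C * (real m ^ p * \<bar>x\<bar> ^ m)" if "m \<ge> 0" for m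
    using mult_right_mono[OF c, of "\<bar>x\<bar> ^ m" m] by (simp add: abs_mult power_abs mult.assoc)
qed

lemma qsum_deriv:
  assumes c: "\<And>m. \<bar>c m\<bar> \<le> C * real m ^ p" and t: "t > 0"
  shows "(qsum c has_real_derivative - 2 * pi * qsum (\<lambda>m. real m * c m) t) (at t)"
proof -
  define x where "x = - exp (- 2 * pi * t)"
  have x: "norm x < 1" using t by (simp add: x_def)
  have sm: "summable (\<lambda>m. c m * y ^ m)" if "norm y < 1" for y
    by (rule summable_poly_bounded_powser[OF c]) (use that in simp)
  from powser_log_deriv(2)[OF sm x]
  obtain D where D: "((\<lambda>x. \<Sum>n. c n * x ^ n) has_field_derivative D) (at x)"
    and xD: "x * D = (\<Sum>n. real n * c n * x ^ n)"
    by blast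
  have "((\<lambda>t. - exp (- 2 * pi * t)) has_real_derivative (- 2 * pi * x)) (at t)"
    unfolding x_def by (auto intro!: derivative_eq_intros)
  from DERIV_chain2[OF D[unfolded x_def] this]
  have "(qsum c has_real_derivative D * (- 2 * pi * x)) (at t)"
    unfolding qsum_def[abs_def] .
  moreover have "D * (- 2 * pi * x) = - 2 * pi * qsum (\<lambda>m. real m * c m) t"
  proof -
    have "D * (- 2 * pi * x) = - 2 * pi * (x * D)" by simp
    then show ?thesis unfolding xD unfolding qsum_def x_def .
  qed
  ultimately show ?thesis by (simp only:)
qed

lemma qsum_approx:
  assumes c: "\<And>m. \<bar>c m - real m ^ q\<bar> \<le> e * real m ^ q" and t: "t > 0"
  shows "\<bar>qsum c t - (\<Sum>m. real m ^ q * (- exp (- 2 * pi * t)) ^ m)\<bar> \<le>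
     e * (\<Sum>m. real m ^ q * exp (- 2 * pi * t) ^ m)"
proof -
  define x where "x = exp (- 2 * pi * t)"
  have x: "0 < x" "x < 1" using t by (simp_all add: x_def)
  have b: "\<bar>c m\<bar> \<le> (1 + e) * real m ^ q" for m
  proof -
    have "real m ^ q \<ge> 0" by simp
    then have "\<bar>c m\<bar> \<le> e * real m ^ q + real m ^ q" using c[of m] by linarith
    then show ?thesis by (simp add: distrib_right)
  qed
  have s1: "summable (\<lambda>m. c m * (- x) ^ m)"
    by (rule summable_poly_bounded_powser[OF b]) (use x in simp)
  have s2: "summable (\<lambda>m. real m ^ q * (- x) ^ m)" "summable (\<lambda>m. real m ^ q * x ^ m)"
    by (rule summable_nat_power_powser; use x in simp)+
  have "\<bar>(\<Sum>m. c m * (- x) ^ m - real m ^ q * (- x) ^ m)\<bar> \<le> (\<Sum>m. e * (real m ^ q * x ^ m))"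
  proof (rule norm_suminf_le[where 'a = real, unfolded real_norm_def])
    show "\<bar>c m * (- x) ^ m - real m ^ q * (- x) ^ m\<bar> \<le> e * (real m ^ q * x ^ m)" for m
      using mult_right_mono[OF c, of "x ^ m" m] x
      by (simp add: abs_mult power_abs mult.assoc flip: left_diff_distrib)
    show "summable (\<lambda>m. e * (real m ^ q * x ^ m))"
      by (intro summable_mult s2)
  qed
  then show ?thesis
    unfolding qsum_def x_def[symmetric] suminf_diff[OF s1 s2(1)] suminf_mult[OF s2(2)] .
qed

text \<open>The coefficient error is multiplied by the series without alternating signs, that is by
  its value on the imaginary axis. There the main term is \<open>1 / t ^ (p + 2)\<close>, larger
  than that of the alternating series by a power of r / t, which the smallness of e has to
  outweigh.\<close>

lemma qsum_lattice:
  assumes c: "\<And>m. \<bar>c m - real m ^ (p + 1)\<bar> \<le> e * real m ^ (p + 1)" and "e \<ge> 0" and t: "t > 0"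
    and h: "h \<ge> 1" "2 * h \<le> p + 2"
  shows "\<bar>(2 * pi) ^ (p + 2) / (2 * fact (p + 1)) * qsum c t -
      (\<Sum>j. Re (inverse (Complex t (- (real j + 1 / 2)) ^ (p + 2))))\<bar> \<le>
      e / 2 * ((1 + pi\<^sup>2 * t\<^sup>2 / (3 * real h)) / t ^ (p + 2))"
proof -
  define A :: real where "A = 2 * fact (p + 1) / (2 * pi) ^ (p + 2)"
  have A: "A > 0" by (simp add: A_def)
  have "\<bar>qsum c t - A * (\<Sum>j. Re (inverse (Complex t (- (real j + 1 / 2)) ^ (p + 2))))\<bar> \<le>
     e * (\<Sum>m. real m ^ (p + 1) * exp (- 2 * pi * t) ^ m)"
    unfolding A_def alternating_lipschitz(2)[OF t, symmetric] by (rule qsum_approx[OF c t])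
  also have "\<dots> \<le> e * (A / 2 * ((1 + pi\<^sup>2 * t\<^sup>2 / (3 * real h)) / t ^ (p + 2)))"
  proof (rule mult_left_mono[OF _ \<open>e \<ge> 0\<close>])
    have "2 * a / b / 2 = a / b" for a b :: real by simp
    then show "(\<Sum>m. real m ^ (p + 1) * exp (- 2 * pi * t) ^ m) \<le>
        A / 2 * ((1 + pi\<^sup>2 * t\<^sup>2 / (3 * real h)) / t ^ (p + 2))"
      unfolding A_def using lipschitz_sum_bound[OF t h] by (simp only:)
  qed
  also have "e * (A / 2 * ((1 + pi\<^sup>2 * t\<^sup>2 / (3 * real h)) / t ^ (p + 2))) =
      A * (e / 2 * ((1 + pi\<^sup>2 * t\<^sup>2 / (3 * real h)) / t ^ (p + 2)))"
    by simp
  finally have le: "\<bar>qsum c t - A * (\<Sum>j. Re (inverse (Complex t (- (real j + 1 / 2)) ^ (p + 2))))\<bar> \<le>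
      A * (e / 2 * ((1 + pi\<^sup>2 * t\<^sup>2 / (3 * real h)) / t ^ (p + 2)))"
  .
  have eqA: "\<bar>q - A * s\<bar> = A * \<bar>inverse A * q - s\<bar>" for q s
  proof -
    have "q - A * s = A * (inverse A * q - s)"
      using A by (simp add: right_diff_distrib flip: mult.assoc)
    then show ?thesis
      using A by (simp only: abs_mult abs_of_pos)
  qed
  have "\<bar>inverse A * qsum c t - (\<Sum>j. Re (inverse (Complex t (- (real j + 1 / 2)) ^ (p + 2))))\<bar> \<le>
      e / 2 * ((1 + pi\<^sup>2 * t\<^sup>2 / (3 * real h)) / t ^ (p + 2))"
    by (rule mult_left_le_imp_le[OF le[unfolded eqA] A])
  then show ?thesis
    by (simp only: A_def inverse_divide)
qed

text \<open>This is where \<open>t \<ge> sqrt 3 / 2\<close> enters: it gives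
  \<open>(r / t)^2 \<le> 4/3\<close>, and together with the powers of 1/2 in e this decays like
  \<open>3 ^ -h\<close>. Even with the crude bound \<open>r \<le> 1.8 * 3 ^ (h - 5)\<close> the
  powers of 3 cancel, leaving \<open>3 ^ -5\<close>, and the case h = 5 determines 13/100.\<close>

lemma lattice_error_bound:
  fixes t r :: real and h :: nat
  assumes r: "r > 0" "r\<^sup>2 = t\<^sup>2 + 1 / 4" "34 / 10 * r\<^sup>2 \<le> real (2 * h + 1)" and h: "h \<ge> 5"
    and t: "t \<ge> sqrt 3 / 2"
  defines "L \<equiv> 1 + pi\<^sup>2 * t\<^sup>2 / (3 * real h)" and "e \<equiv> 9 / 8 * (1 / 2) ^ (2 * h - 1)"
  shows "e * L * (r ^ (2 * h + 3) / t ^ (2 * h + 2) + r ^ (2 * h + 2) / t ^ (2 * h + 1)) \<le> 13 / 100"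
proof -
  have t0: "t > 0"
    by (rule less_le_trans[OF _ t]) simp
  have t2: "t\<^sup>2 \<ge> 3 / 4"
    using power_mono[OF t, of 2] by (simp add: power_divide)
  have "pi\<^sup>2 \<le> (3.1416)\<^sup>2"
    using pi_approx by (intro power_mono) auto
  then have pi2: "pi\<^sup>2 \<le> 98698 / 10000" by (simp add: power2_eq_square)
  have "t\<^sup>2 \<le> 6 / 10 * real h"
    using r h by simp
  then have "pi\<^sup>2 * t\<^sup>2 \<le> 98698 / 10000 * (6 / 10 * real h)"
    using pi2 by (intro mult_mono) auto
  then have L: "L \<le> 3" and L0: "L \<ge> 0"
    using h unfolding L_def by (auto simp: divide_simps)
  define u where "u = r / t"
  have u0: "u > 0" using r t0 by (simp add: u_def)
  have "u\<^sup>2 \<le> 4 / 3"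
    using t2 t0 unfolding u_def power_divide r(2) by (simp add: divide_simps)
  then have u2: "(u / 2)\<^sup>2 \<le> 1 / 3" by (simp add: power_divide)
  have uh: "u / 2 \<le> 5774 / 10000"
    by (rule power2_le_imp_le) (use u2 in \<open>auto simp: power2_eq_square\<close>)
  have "2 * real h + 1 \<le> 11 * 3 ^ (h - 5)"
    using h
  proof (induction h rule: dec_induct)
    case (step n)
    then have "(3 :: real) ^ (Suc n - 5) = 3 * 3 ^ (n - 5)"
      by (simp only: Suc_diff_le power_Suc)
    moreover have "(3 :: real) ^ (n - 5) \<ge> 1" by simp
    ultimately show ?case
      using step.IH by simp
  qed simp
  then have "r\<^sup>2 \<le> 324 / 100 * 3 ^ (h - 5)"
    using r by simp
  also have "\<dots> \<le> 324 / 100 * (3 ^ (h - 5))\<^sup>2"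
    by (simp add: power2_eq_square mult_le_cancel_left1)
  also have "\<dots> = (18 / 10 * 3 ^ (h - 5))\<^sup>2"
    unfolding power_mult_distrib by (simp add: power2_eq_square)
  finally have rb: "r \<le> 18 / 10 * 3 ^ (h - 5)"
    by (rule power2_le_imp_le) simp
  have p2: "(1 / 2 :: real) ^ (2 * h - 1) = 4 * (1 / 2) ^ (2 * h + 1)"
  proof -
    have "2 * h + 1 = (2 * h - 1) + 2" using h by simp
    then have "(1 / 2 :: real) ^ (2 * h + 1) = (1 / 2) ^ (2 * h - 1) * (1 / 2)\<^sup>2"
      by (simp only: power_add)
    then show ?thesis by (simp add: power2_eq_square)
  qed
  have "r ^ (2 * h + 3) / t ^ (2 * h + 2) + r ^ (2 * h + 2) / t ^ (2 * h + 1) =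
      r * u ^ (2 * h + 1) * (u + 1)"
  proof -
    have "r ^ (2 * h + 3) = r * r ^ (2 * h + 2)" "r ^ (2 * h + 2) = r * r ^ (2 * h + 1)"
      by (simp_all add: eval_nat_numeral)
    then have "r ^ (2 * h + 3) / t ^ (2 * h + 2) = r * u ^ (2 * h + 2)"
      "r ^ (2 * h + 2) / t ^ (2 * h + 1) = r * u ^ (2 * h + 1)"
      unfolding u_def power_divide by simp_all
    moreover have "u ^ (2 * h + 2) = u ^ (2 * h + 1) * u"
      by simp
    ultimately show ?thesis
      by (simp only: distrib_left mult.assoc mult_1_right)
  qed
  also have "e * L * (r * u ^ (2 * h + 1) * (u + 1)) = 9 / 2 * L * (r * (u / 2) ^ (2 * h + 1) * (u + 1))"
  proof -
    have "(u / 2) ^ (2 * h + 1) = u ^ (2 * h + 1) * (1 / 2) ^ (2 * h + 1)"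
      by (simp only: power_mult_distrib[symmetric]) simp
    moreover have "9 / 8 * (4 * P) * L * (r * U * w) = 9 / 2 * L * (r * (U * P) * w)" for P U w :: real
      by simp
    ultimately show ?thesis
      unfolding e_def p2 by (simp only:)
  qed
  also have "(u / 2) ^ (2 * h + 1) = ((u / 2)\<^sup>2) ^ h * (u / 2)"
    by (simp add: power_mult)
  also have "9 / 2 * L * (r * (((u / 2)\<^sup>2) ^ h * (u / 2)) * (u + 1)) \<le>
      9 / 2 * 3 * (18 / 10 * 3 ^ (h - 5) * ((1 / 3) ^ h * (5774 / 10000)) * (2155 / 1000))"
    using L L0 rb u2 uh u0 r by (intro mult_mono power_mono mult_nonneg_nonneg) auto
  also have "\<dots> = 9 / 2 * 3 * (18 / 10 * (5774 / 10000) * (2155 / 1000)) * (3 ^ (h - 5) * (1 / 3) ^ h)"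
    by simp
  also have "(3 :: real) ^ (h - 5) * (1 / 3) ^ h = 1 / 243"
  proof -
    have "(3 :: real) ^ ((h - 5) + 5) = 3 ^ (h - 5) * 3 ^ 5"
      by (rule power_add)
    then have "(3 :: real) ^ h = 3 ^ (h - 5) * 3 ^ 5"
      using h by simp
    then show ?thesis by (simp add: power_divide)
  qed
  also have "9 / 2 * 3 * (18 / 10 * (5774 / 10000) * (2155 / 1000)) * (1 / 243) \<le> 13 / (100 :: real)"
    by simp
  finally show ?thesis .
qed

section \<open>Value and Wronskian at a single height in the lattice region\<close>

definition lattice_scale :: "nat \<Rightarrow> real" where
  "lattice_scale k = (2 * pi) ^ (k + 1) / (2 * fact k)"

lemma lattice_scale_pos: "lattice_scale k > 0"
  by (simp add: lattice_scale_def)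

lemma sigma_coeff_approx:
  assumes "k \<ge> 10"
  shows "\<bar>sigma_coeff k m - real m ^ k\<bar> \<le> 9 / 8 * (1 / 2) ^ (k - 1) * real m ^ k"
    and "\<bar>real m * sigma_coeff k m - real m ^ (k + 1)\<bar> \<le> 9 / 8 * (1 / 2) ^ (k - 1) * real m ^ (k + 1)"
proof -
  show *: "\<bar>sigma_coeff k m - real m ^ k\<bar> \<le> 9 / 8 * (1 / 2) ^ (k - 1) * real m ^ k"
    using sigma_coeff_bounds[OF assms, of m] by (simp only: abs_le_iff distrib_right) simp
  have "\<bar>real m * sigma_coeff k m - real m ^ (k + 1)\<bar> = real m * \<bar>sigma_coeff k m - real m ^ k\<bar>"
    by (simp add: abs_mult flip: right_diff_distrib)
  also have "\<dots> \<le> real m * (9 / 8 * (1 / 2) ^ (k - 1) * real m ^ k)"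
    by (rule mult_left_mono[OF *]) simp
  finally show "\<bar>real m * sigma_coeff k m - real m ^ (k + 1)\<bar> \<le> 9 / 8 * (1 / 2) ^ (k - 1) * real m ^ (k + 1)"
    by (simp add: mult_ac)
qed

lemma qsum_sigma_deriv:
  assumes "k \<ge> 10" "t > 0"
  shows "(qsum (sigma_coeff k) has_real_derivative
     - 2 * pi * qsum (\<lambda>m. real m * sigma_coeff k m) t) (at t)"
proof (rule qsum_deriv[OF _ assms(2)])
  fix m
  have "0 \<le> real m ^ k" by simp
  then show "\<bar>sigma_coeff k m\<bar> \<le> (1 + 9 / 8 * (1 / 2) ^ (k - 1)) * real m ^ k"
    using sigma_coeff_bounds[OF assms(1), of m] by linarith
qed

text \<open>One height t with its lattice points \<open>v j\<close> and their powers
  \<open>V j\<close>; w and W are the point and the power for j = 0. Multiplication by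
  \<open>lattice_scale k\<close>, the reciprocal of the constant in Lipschitz' formula, gives W the
  coefficient 1.\<close>

locale lattice_regime =
  fixes k h :: nat and t r :: real and w W :: complex and V :: "nat \<Rightarrow> complex" and v :: "nat \<Rightarrow> complex"
  assumes k: "k = 2 * h" and h: "h \<ge> 5"
    and t: "t \<ge> sqrt 3 / 2"
    and r: "r > 0" "r\<^sup>2 = t\<^sup>2 + 1 / 4" "34 / 10 * r\<^sup>2 \<le> real (k + 1)"
  defines "w \<equiv> Complex t (- 1 / 2)" and "W \<equiv> inverse (w ^ (k + 1))"
    and "v \<equiv> \<lambda>j. Complex t (- (real j + 1 / 2))" and "V \<equiv> \<lambda>j. inverse (v j ^ (k + 1))"
begin

lemma V_div_v: "V j / v j = inverse (Complex t (- (real j + 1 / 2)) ^ (k + 2))"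
proof -
  have "inverse (z ^ (k + 1)) / z = inverse (z ^ (k + 2))" for z :: complex
    by (simp add: divide_inverse mult_ac)
  then show ?thesis by (simp only: V_def v_def)
qed

lemma t_pos: "t > 0"
  by (rule less_le_trans[OF _ t]) simp

lemma norm_w: "norm w = r"
proof -
  have "(norm w)\<^sup>2 = r\<^sup>2"
    unfolding w_def cmod_power2 r(2) by (simp add: power2_eq_square)
  then show ?thesis using r(1) by (simp add: power2_eq_iff_nonneg)
qed

lemma norm_W: "norm W = 1 / r ^ (k + 1)"
  unfolding W_def norm_inverse norm_power norm_w by (rule inverse_eq_divide)

lemma w_V0: "v 0 = w" "V 0 = W"
  by (simp_all add: v_def w_def V_def W_def)

lemma r_ge_1: "r \<ge> 1"
proof -
  have "t\<^sup>2 \<ge> 3 / 4"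
    using power_mono[OF t, of 2] by (simp add: power_divide)
  then have "1\<^sup>2 \<le> r\<^sup>2" by (simp add: r(2))
  then show ?thesis by (rule power2_le_imp_le) (use r(1) in simp)
qed

lemma V_tail: "r ^ (k + 1) * norm (V (Suc j)) * (3 * real (Suc j) + 5 / 2) \<le> lattice_majorant j"
  unfolding V_def v_def k using lattice_term_bound[OF r(1,2) r(3)[unfolded k] h] .

definition L :: real where "L = 1 + pi\<^sup>2 * t\<^sup>2 / (3 * real h)"
definition e :: real where "e = 9 / 8 * (1 / 2) ^ (k - 1)"

lemma eL_nonneg: "e \<ge> 0" "L \<ge> 0"
  by (simp_all add: e_def L_def)

lemma value_expansion:
  "\<bar>lattice_scale k * qsum (sigma_coeff k) t - (\<Sum>j. Re (V j))\<bar> \<le> e / 2 * (L / t ^ (k + 1))"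
proof -
  have p: "k - 1 + 1 = k" "k - 1 + 2 = k + 1" using h k by auto
  have hh: "1 \<le> h" "2 * h \<le> k - 1 + 2" using h k by auto
  note lat = qsum_lattice[where c = "sigma_coeff k" and p = "k - 1" and e = e and t = t and h = h, unfolded p]
  show ?thesis
    unfolding V_def v_def lattice_scale_def L_def
    by (rule lat[OF _ eL_nonneg(1) t_pos hh(1) hh(2)[unfolded p]])
       (unfold e_def, rule sigma_coeff_approx(1), use h k in simp)
qed

text \<open>The lattice sum is not differentiated term by term. Lipschitz' formula is applied anew
  with exponent k + 2 to the coefficients \<open>m * sigma_coeff k m\<close>, which have the same
  relative error.\<close>

lemma deriv_expansion:
  "\<bar>lattice_scale k * (2 * pi * qsum (\<lambda>m. real m * sigma_coeff k m) t) -
     real (k + 1) * (\<Sum>j. Re (V j / v j))\<bar> \<le> real (k + 1) * (e / 2 * (L / t ^ (k + 2)))"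
proof -
  define q where "q = qsum (\<lambda>m. real m * sigma_coeff k m) t"
  have hh: "1 \<le> h" "2 * h \<le> k + 2" "k \<ge> 10" using h k by auto
  have "\<bar>(2 * pi) ^ (k + 2) / (2 * fact (k + 1)) * q - (\<Sum>j. Re (V j / v j))\<bar> \<le> e / 2 * (L / t ^ (k + 2))"
    unfolding V_div_v q_def L_def
    by (rule qsum_lattice[OF _ eL_nonneg(1) t_pos hh(1,2)])
       (use sigma_coeff_approx(2)[OF hh(3)] in \<open>simp only: e_def\<close>)
  then have "real (k + 1) * \<bar>(2 * pi) ^ (k + 2) / (2 * fact (k + 1)) * q - (\<Sum>j. Re (V j / v j))\<bar> \<le>
      real (k + 1) * (e / 2 * (L / t ^ (k + 2)))"
    by (rule mult_left_mono) simp
  moreover have "real (k + 1) * \<bar>(2 * pi) ^ (k + 2) / (2 * fact (k + 1)) * q - (\<Sum>j. Re (V j / v j))\<bar> =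
     \<bar>real (k + 1) * ((2 * pi) ^ (k + 2) / (2 * fact (k + 1)) * q - (\<Sum>j. Re (V j / v j)))\<bar>"
    by (simp only: abs_mult abs_of_nat)
  moreover have "real (k + 1) * ((2 * pi) ^ (k + 2) / (2 * fact (k + 1)) * q - (\<Sum>j. Re (V j / v j))) =
     lattice_scale k * (2 * pi * q) - real (k + 1) * (\<Sum>j. Re (V j / v j))"
  proof -
    have P: "(2 * pi) ^ (k + 2) = (2 * pi) ^ (k + 1) * (2 * pi)"
      and F: "(fact (k + 1) :: real) = real (k + 1) * fact k"
      by simp_all
    have cancel: "c * (P * X / (2 * (c * f)) * q - S) = P / (2 * f) * (X * q) - c * S"
      if "c \<noteq> 0" "f \<noteq> 0" for c P X f S :: real
      using that by (simp add: field_simps)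
    show ?thesis
      unfolding lattice_scale_def P F by (rule cancel) simp_all
  qed
  ultimately show ?thesis
    unfolding q_def by (simp only:)
qed

lemma error_bound:
  "e * L * (r ^ (k + 3) / t ^ (k + 2) + r ^ (k + 2) / t ^ (k + 1)) \<le> 13 / 100"
  using lattice_error_bound[OF r(1,2) r(3)[unfolded k] h t, folded k] unfolding e_def L_def .

lemma summable_ReV: "summable (\<lambda>j. Re (V j))" "summable (\<lambda>j. Re (V j / v j))"
proof -
  have p: "k - 1 + 2 = k + 1" using h k by auto
  show "summable (\<lambda>j. Re (V j))"
    using alternating_lipschitz(1)[OF t_pos, of "k - 1"] by (simp only: p V_def v_def)
  show "summable (\<lambda>j. Re (V j / v j))"
    unfolding V_div_v by (rule alternating_lipschitz(1)[OF t_pos])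
qed

text \<open>The other lattice points contribute at most 0.62 and the coefficient error at most
  0.065. The result has to stay below \<open>sqrt 3 / 2\<close>, the smallest modulus of the cosine
  at a point where a sign is read off.\<close>

lemma value_bound:
  "r ^ (k + 1) * \<bar>lattice_scale k * qsum (sigma_coeff k) t - Re W\<bar> \<le> 7 / 10"
proof -
  have rk: "r ^ (k + 1) > 0" using r(1) by simp
  have tail: "\<bar>\<Sum>j. r ^ (k + 1) * Re (V (Suc j))\<bar> \<le> suminf lattice_majorant"
  proof (rule norm_suminf_le[where 'a = real, unfolded real_norm_def])
    fix j
    have "\<bar>r ^ (k + 1) * Re (V (Suc j))\<bar> \<le> r ^ (k + 1) * norm (V (Suc j))"
        unfolding abs_mult using rk by (intro mult_mono abs_Re_le_cmod) auto
    also have "\<dots> \<le> r ^ (k + 1) * norm (V (Suc j)) * (3 * real (Suc j) + 5 / 2)"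
      using mult_left_mono[of 1 "3 * real (Suc j) + 5 / 2" "r ^ (k + 1) * norm (V (Suc j))"] rk
      by simp
    also note V_tail
    finally show "\<bar>r ^ (k + 1) * Re (V (Suc j))\<bar> \<le> lattice_majorant j" .
  qed (rule lattice_majorant_sum)
  have sS: "summable (\<lambda>j. Re (V (Suc j)))"
    using summable_ReV(1) by (subst summable_Suc_iff)
  have eq: "(\<Sum>j. r ^ (k + 1) * Re (V (Suc j))) = r ^ (k + 1) * ((\<Sum>j. Re (V j)) - Re W)"
    unfolding suminf_mult[OF sS] using suminf_split_head[OF summable_ReV(1)] w_V0 by simp
  have "r ^ (k + 1) * (e / 2 * (L / t ^ (k + 1))) = 1 / 2 * (e * L * (r ^ (k + 1) / t ^ (k + 1)))"
    by simp
  also have "r ^ (k + 1) / t ^ (k + 1) \<le> r ^ (k + 3) / t ^ (k + 2) + r ^ (k + 2) / t ^ (k + 1)"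
  proof -
    have "r ^ (k + 1) \<le> r ^ (k + 2)"
      using r_ge_1 by (intro power_increasing) auto
    then have "r ^ (k + 1) / t ^ (k + 1) \<le> r ^ (k + 2) / t ^ (k + 1)"
      using t_pos by (intro divide_right_mono) auto
    moreover have "0 \<le> r ^ (k + 3) / t ^ (k + 2)"
      using t_pos r(1) by simp
    ultimately show ?thesis by linarith
  qed
  also note error_bound
  finally have err: "r ^ (k + 1) * (e / 2 * (L / t ^ (k + 1))) \<le> 13 / 200"
    using eL_nonneg by (simp add: mult_left_mono)
  have "r ^ (k + 1) * \<bar>lattice_scale k * qsum (sigma_coeff k) t - (\<Sum>j. Re (V j))\<bar> \<le> 13 / 200"
    using mult_left_mono[OF value_expansion, of "r ^ (k + 1)"] rk err by linarith
  moreover have "r ^ (k + 1) * \<bar>(\<Sum>j. Re (V j)) - Re W\<bar> \<le> 62 / 100"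
    using tail[unfolded eq abs_mult] lattice_majorant_sum(2) rk by simp
  moreover have "r ^ (k + 1) * \<bar>lattice_scale k * qsum (sigma_coeff k) t - Re W\<bar> \<le>
     r ^ (k + 1) * (\<bar>lattice_scale k * qsum (sigma_coeff k) t - (\<Sum>j. Re (V j))\<bar> + \<bar>(\<Sum>j. Re (V j)) - Re W\<bar>)"
    using rk by (intro mult_left_mono) auto
  ultimately show ?thesis by (simp only: distrib_left)
qed

text \<open>
  The derivative of \<open>Im W\<close> with respect to \<open>t\<close> is \<open>-(k+1) * Im (W / w)\<close>, so the left-hand side is the
  numerator of the derivative of \<open>lattice_scale k * F t / Im W\<close>.
\<close>
lemma wronskian_pos:
  "lattice_scale k * (- 2 * pi * qsum (\<lambda>m. real m * sigma_coeff k m) t) * Im W +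
   lattice_scale k * qsum (sigma_coeff k) t * (real (k + 1) * Im (W / w)) > 0"
proof -
  define n where "n = real (k + 1)"
  define F where "F = lattice_scale k * qsum (sigma_coeff k) t"
  define G where "G = lattice_scale k * (2 * pi * qsum (\<lambda>m. real m * sigma_coeff k m) t)"
  define S where "S = (\<Sum>j. Re (V j))"
  define S' where "S' = (\<Sum>j. Re (V j / v j))"
  define T where "T = (\<lambda>j. Re (V j / v j) * Im W - Re (V j) * Im (W / w))"
  have weq: "w = Complex t (- 1 / 2)" by (simp only: w_def)
  have n: "n > 0" by (simp add: n_def)
  have rk: "r ^ (k + 1) > 0" using r(1) by simp
  \<comment> \<open>This identity trades powers of r for \<open>norm W\<close>, so that the main
    term, the tail and the error are all measured in units of \<open>(norm W)^2\<close>.\<close>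
  have nW: "norm W * r ^ (k + 1) = 1"
  proof -
    have "1 / x * x = 1" if "x > 0" for x :: real using that by simp
    then show ?thesis unfolding norm_W using rk .
  qed
  have nW0: "norm W > 0"
    unfolding norm_W using rk by simp
  have sT: "T sums (S' * Im W - S * Im (W / w))"
    unfolding T_def S_def S'_def
    by (intro sums_diff sums_mult2 summable_sums summable_ReV)
  have T0: "2 * r\<^sup>2 * T 0 = - (norm W)\<^sup>2"
  proof -
    have "w \<noteq> 0" using norm_w r(1) by auto
    then have "T 0 = - ((norm W)\<^sup>2 / (2 * r\<^sup>2))"
      unfolding T_def w_V0 norm_w[symmetric] by (rule wronskian_lattice_main[OF weq])
    then show ?thesis using r(1) by simp
  qed
  have tail: "\<bar>2 * r\<^sup>2 * T (Suc j)\<bar> \<le> (norm W)\<^sup>2 * lattice_majorant j" for j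
  proof -
    have "\<bar>2 * r\<^sup>2 * T (Suc j)\<bar> = 2 * r\<^sup>2 * \<bar>T (Suc j)\<bar>"
      by (simp add: abs_mult)
    also have "\<dots> \<le> norm (V (Suc j)) * norm W * (3 * (real (Suc j) + 1 / 2) + 1)"
      unfolding T_def
      by (rule wronskian_lattice_term[OF _ _ _ weq norm_w[symmetric] r(1)])
         (use t_pos in \<open>simp_all add: v_def\<close>)
    also have "\<dots> = norm W * (norm W * r ^ (k + 1)) * (norm (V (Suc j)) * (3 * real (Suc j) + 5 / 2))"
      unfolding nW by (simp add: algebra_simps)
    also have "\<dots> = (norm W)\<^sup>2 * (r ^ (k + 1) * norm (V (Suc j)) * (3 * real (Suc j) + 5 / 2))"
      by (simp only: power2_eq_square mult_ac)
    also have "\<dots> \<le> (norm W)\<^sup>2 * lattice_majorant j"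
      by (intro mult_left_mono V_tail) simp
    finally show ?thesis .
  qed
  have "\<bar>\<Sum>j. 2 * r\<^sup>2 * T (Suc j)\<bar> \<le> (\<Sum>j. (norm W)\<^sup>2 * lattice_majorant j)"
    by (rule norm_suminf_le[where 'a = real, unfolded real_norm_def])
       (rule tail, intro summable_mult lattice_majorant_sum)
  also have "\<dots> = (norm W)\<^sup>2 * suminf lattice_majorant"
    by (rule suminf_mult[OF lattice_majorant_sum(1)])
  also have "\<dots> \<le> (norm W)\<^sup>2 * (62 / 100)"
    by (intro mult_left_mono lattice_majorant_sum) simp
  also have "(\<Sum>j. 2 * r\<^sup>2 * T (Suc j)) = 2 * r\<^sup>2 * (suminf T - T 0)"
  proof -
    have "summable (\<lambda>j. T (Suc j))"
      using sums_summable[OF sT] by (subst summable_Suc_iff)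
    then show ?thesis
      using suminf_mult[of "\<lambda>j. T (Suc j)" "2 * r\<^sup>2"] suminf_split_head[OF sums_summable[OF sT]]
      by simp
  qed
  also have "2 * r\<^sup>2 * (suminf T - T 0) = 2 * r\<^sup>2 * suminf T + (norm W)\<^sup>2"
    unfolding right_diff_distrib T0 by simp
  \<comment> \<open>\<open>T 0\<close> contributes -1 and the remaining lattice points at most 0.62,
    in units of \<open>(norm W)^2\<close>.\<close>
  finally have main: "2 * r\<^sup>2 * (S' * Im W - S * Im (W / w)) \<le> - (38 / 100) * (norm W)\<^sup>2"
    unfolding sums_unique[OF sT, symmetric] by linarith
  have e1: "\<bar>G - n * S'\<bar> \<le> n * (e / 2 * (L / t ^ (k + 2)))"
    using deriv_expansion by (simp only: G_def n_def S'_def)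
  have e0: "\<bar>F - S\<bar> \<le> e / 2 * (L / t ^ (k + 1))"
    using value_expansion by (simp only: F_def S_def)
  have i1: "\<bar>(G - n * S') * Im W\<bar> \<le> n * (e / 2 * (L / t ^ (k + 2))) * norm W"
    unfolding abs_mult by (intro mult_mono e1 abs_Im_le_cmod) (use n t_pos eL_nonneg in auto)
  have "\<bar>Im (W / w)\<bar> \<le> norm W / r"
    using abs_Im_le_cmod[of "W / w"] by (simp add: norm_divide norm_w)
  then have i0: "\<bar>(F - S) * (n * Im (W / w))\<bar> \<le> e / 2 * (L / t ^ (k + 1)) * (n * (norm W / r))"
    unfolding abs_mult using n t_pos eL_nonneg by (intro mult_mono e0) auto
  have "2 * r\<^sup>2 * (n * (e / 2 * (L / t ^ (k + 2))) * norm W + e / 2 * (L / t ^ (k + 1)) * (n * (norm W / r))) =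
      n * norm W * (e * L * (r\<^sup>2 / t ^ (k + 2) + r / t ^ (k + 1)))"
    using r(1) by (simp add: power2_eq_square algebra_simps)
  also have "\<dots> = n * (norm W)\<^sup>2 * (e * L * (r ^ (k + 3) / t ^ (k + 2) + r ^ (k + 2) / t ^ (k + 1)))"
  proof -
    have "r ^ (k + 3) = r ^ (k + 1) * r\<^sup>2" "r ^ (k + 2) = r ^ (k + 1) * r"
      by (simp_all add: eval_nat_numeral)
    then have X: "(norm W)\<^sup>2 * (e * L * (r ^ (k + 3) / t ^ (k + 2) + r ^ (k + 2) / t ^ (k + 1))) =
        norm W * (norm W * r ^ (k + 1)) * (e * L * (r\<^sup>2 / t ^ (k + 2) + r / t ^ (k + 1)))"
      by (simp add: power2_eq_square algebra_simps)
    show ?thesis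
      unfolding mult.assoc[of n] X unfolding nW by (simp only: mult_1_right)
  qed
  also have "\<dots> \<le> n * (norm W)\<^sup>2 * (13 / 100)"
    by (intro mult_left_mono error_bound) (use n in auto)
  finally have err: "2 * r\<^sup>2 * (n * (e / 2 * (L / t ^ (k + 2))) * norm W + e / 2 * (L / t ^ (k + 1)) * (n * (norm W / r)))
      \<le> n * (norm W)\<^sup>2 * (13 / 100)" .
  have "- ((G - n * S') * Im W) + (F - S) * (n * Im (W / w)) \<ge>
      - (n * (e / 2 * (L / t ^ (k + 2))) * norm W + e / 2 * (L / t ^ (k + 1)) * (n * (norm W / r)))"
    using i1 i0 by linarith
  then have "2 * r\<^sup>2 * (- ((G - n * S') * Im W) + (F - S) * (n * Im (W / w))) \<ge>
      2 * r\<^sup>2 * (- (n * (e / 2 * (L / t ^ (k + 2))) * norm W + e / 2 * (L / t ^ (k + 1)) * (n * (norm W / r))))"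
    by (rule mult_left_mono) simp
  then have low: "2 * r\<^sup>2 * (- ((G - n * S') * Im W) + (F - S) * (n * Im (W / w))) \<ge> - (n * (norm W)\<^sup>2 * (13 / 100))"
    using err by (simp only: mult_minus_right)
  have "n * (2 * r\<^sup>2 * (S' * Im W - S * Im (W / w))) \<le> n * (- (38 / 100) * (norm W)\<^sup>2)"
    using main n by (intro mult_left_mono) auto
  \<comment> \<open>The coefficient error 0.13 is taken from 0.38, and 0.25 remains.\<close>
  then have "2 * r\<^sup>2 * (- G * Im W + F * (n * Im (W / w))) \<ge> n * (norm W)\<^sup>2 * (25 / 100)"
    using low by (simp add: algebra_simps)
  moreover have "n * (norm W)\<^sup>2 * (25 / 100) > 0"
    using n nW0 by simp
  ultimately have "2 * r\<^sup>2 * (- G * Im W + F * (n * Im (W / w))) > 0"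
    by linarith
  then have "- G * Im W + F * (n * Im (W / w)) > 0"
    using r(1) by (simp add: zero_less_mult_iff)
  then show ?thesis
    by (simp add: F_def G_def n_def)
qed

end

section \<open>Bounds for the Fourier series\<close>

lemma sum_downward_geometric:
  fixes s :: "nat \<Rightarrow> real"
  assumes "\<And>i. i < n \<Longrightarrow> s i \<le> a * s (Suc i)" "\<And>i. i \<le> n \<Longrightarrow> s i \<ge> 0" "0 \<le> a" "a < 1"
  shows "(\<Sum>i\<le>n. s i) \<le> s n / (1 - a)"
  using assms(1,2)
proof (induction n)
  case 0
  have "s 0 * (1 - a) \<le> s 0" using assms(3) 0(2)[of 0] by (simp add: mult_left_le)
  then show ?case using assms(4) by (simp add: pos_le_divide_eq)
next
  case (Suc n)
  have "(\<Sum>i\<le>n. s i) \<le> s n / (1 - a)"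
    by (rule Suc.IH) (use Suc.prems in auto)
  also have "\<dots> \<le> a * s (Suc n) / (1 - a)"
    using Suc.prems(1)[of n] assms(4) by (intro divide_right_mono) auto
  finally have "(\<Sum>i\<le>Suc n. s i) \<le> a * s (Suc n) / (1 - a) + s (Suc n)"
    by simp
  also have "\<dots> = s (Suc n) / (1 - a)"
    using assms(4) by (simp add: field_simps)
  finally show ?case .
qed

lemma sum_upward_geometric:
  fixes s :: "nat \<Rightarrow> real"
  assumes le: "\<And>i. s (Suc i) \<le> c * s i" and nn: "\<And>i. s i \<ge> 0" and c: "0 \<le> c" "c < 1"
  shows "summable s" "suminf s \<le> s 0 / (1 - c)"
proof -
  have b: "s i \<le> s 0 * c ^ i" for i
  proof (induction i)
    case (Suc i)
    then show ?case
      using le[of i] mult_left_mono[OF Suc c(1)] by (simp add: mult_ac)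
  qed simp
  have g: "(\<lambda>i. s 0 * c ^ i) sums (s 0 * (1 / (1 - c)))"
    by (intro sums_mult geometric_sums) (use c in simp)
  show s: "summable s"
    by (rule summable_comparison_test'[OF sums_summable[OF g], of 0]) (use b nn in auto)
  have "suminf s \<le> (\<Sum>i. s 0 * c ^ i)"
    by (rule suminf_le[OF b s sums_summable[OF g]])
  then show "suminf s \<le> s 0 / (1 - c)"
    using sums_unique[OF g] by simp
qed

text \<open>No ratio is prescribed from \<open>u m\<close> up to \<open>u (Suc l)\<close>, so the
  block from m to l may hold two terms of comparable size. It is used with l = m at a node and with
  l = m + 1 between two nodes.\<close>

lemma alternating_dominant_sum:
  fixes u :: "nat \<Rightarrow> real"
  assumes dn: "\<And>i. i < m \<Longrightarrow> \<bar>u i\<bar> \<le> a * \<bar>u (Suc i)\<bar>" and a: "0 \<le> a" "a < 1"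
    and up: "\<And>i. i > l \<Longrightarrow> \<bar>u (Suc i)\<bar> \<le> c * \<bar>u i\<bar>" and c: "0 \<le> c" "c < 1" and ml: "m \<le> l"
    and a': "m \<ge> 1 \<Longrightarrow> \<bar>u (m - 1)\<bar> / (1 - a) \<le> A" and A: "0 \<le> A"
    and c': "\<bar>u (Suc l)\<bar> / (1 - c) \<le> B"
  shows "\<bar>suminf u - (\<Sum>i=m..l. u i)\<bar> \<le> A + B"
proof -
  have step: "\<bar>u (Suc i + Suc l)\<bar> \<le> c * \<bar>u (i + Suc l)\<bar>" for i
    using up[of "i + Suc l"] by simp
  note U = sum_upward_geometric[of "\<lambda>i. \<bar>u (i + Suc l)\<bar>" c, OF step abs_ge_zero c]
  have sU: "summable (\<lambda>i. \<bar>u (i + Suc l)\<bar>)"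
    by (rule U(1))
  have "suminf (\<lambda>i. \<bar>u (i + Suc l)\<bar>) \<le> \<bar>u (0 + Suc l)\<bar> / (1 - c)"
    by (rule U(2))
  then have bU: "suminf (\<lambda>i. \<bar>u (i + Suc l)\<bar>) \<le> B"
    using c' by simp
  have s1: "summable (\<lambda>i. u (i + Suc l))"
    by (rule summable_rabs_cancel[OF sU])
  have su: "summable u"
    by (rule summable_offset[OF s1])
  have "\<bar>\<Sum>i. u (i + Suc l)\<bar> \<le> B"
    using summable_rabs[OF sU] bU by linarith
  moreover have "\<bar>\<Sum>i<m. u i\<bar> \<le> A"
  proof (cases "m \<ge> 1")
    case True
    then have "{..<m} = {..m - 1}" by auto
    then have "\<bar>\<Sum>i<m. u i\<bar> \<le> (\<Sum>i\<le>m - 1. \<bar>u i\<bar>)"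
      using sum_abs[of u "{..<m}"] by (simp only:)
    also have "\<dots> \<le> \<bar>u (m - 1)\<bar> / (1 - a)"
    proof (rule sum_downward_geometric[OF _ _ a])
      show "\<bar>u i\<bar> \<le> a * \<bar>u (Suc i)\<bar>" if "i < m - 1" for i
        by (rule dn) (use that in simp)
    qed simp
    also note a'[OF True]
    finally show ?thesis .
  next
    case False
    then have "m = 0" by simp
    then show ?thesis using A by simp
  qed
  moreover have "suminf u = (\<Sum>i. u (i + Suc l)) + (\<Sum>i<Suc l. u i)"
    by (rule suminf_split_initial_segment[OF su])
  moreover have "(\<Sum>i<Suc l. u i) = (\<Sum>i<m. u i) + (\<Sum>i=m..l. u i)"
  proof -
    have "{..<Suc l} = {..<m} \<union> {m..l}" using ml by auto
    moreover have "sum u ({..<m} \<union> {m..l}) = (\<Sum>i<m. u i) + (\<Sum>i=m..l. u i)"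
      by (rule sum.union_disjoint) auto
    ultimately show ?thesis by (simp only:)
  qed
  ultimately show "\<bar>suminf u - (\<Sum>i=m..l. u i)\<bar> \<le> A + B" by linarith
qed

section \<open>Elementary inequalities for the cotangent, the exponential and the
  coefficients\<close>

lemma cot_lower_bound:
  assumes y: "0 < y" "y \<le> (48333 / 100000 :: real)"
  shows "1 / y - 35 / 100 * y \<le> cot y"
proof -
  have y2: "y\<^sup>2 \<le> 2337 / 10000"
    using power_mono[OF y(2), of 2] y by (simp add: power2_eq_square)
  have s0: "sin y > 0"
    by (rule sin_gt_zero) (use y pi_gt3 in auto)
  have "\<bar>sin y - (\<Sum>m<5. sin_coeff m * y ^ m)\<bar> \<le> inverse (fact 5) * \<bar>y\<bar> ^ 5"
    by (rule Maclaurin_sin_bound)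
  moreover have "(\<Sum>m<5. sin_coeff m * y ^ m) = y - y ^ 3 / 6"
    by (simp add: eval_nat_numeral sin_coeff_Suc cos_coeff_Suc)
  moreover have "inverse (fact 5) * \<bar>y\<bar> ^ 5 = y ^ 5 / 120"
    using y by (simp add: fact_numeral)
  ultimately have s: "sin y \<le> y - y ^ 3 / 6 + y ^ 5 / 120"
    by linarith
  have "cos y = 1 - 2 * (sin (y / 2))\<^sup>2"
    using cos_double_sin[of "y / 2"] by simp
  moreover have "(sin (y / 2))\<^sup>2 \<le> (y / 2)\<^sup>2"
    using sin_x_le_x[of "y / 2"] y sin_gt_zero[of "y / 2"] pi_gt3
    by (intro power_mono) auto
  ultimately have co: "cos y \<ge> 1 - y\<^sup>2 / 2"
    by (simp add: power_divide)
  \<comment> \<open>The expansion of the cotangent begins with 1/y - y/3. Replacing 1/3 by 0.35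
    absorbs all further terms up to y = \<open>2 * pi / 13\<close>, the angle of the second node for
    k = 12, which is just below 0.48333.\<close>
  have "(1 - 35 / 100 * y\<^sup>2) * sin y \<le> (1 - 35 / 100 * y\<^sup>2) * (y - y ^ 3 / 6 + y ^ 5 / 120)"
    by (rule mult_left_mono[OF s]) (use y2 in simp)
  also have "\<dots> = y * ((1 - 35 / 100 * y\<^sup>2) * (1 - y\<^sup>2 / 6 + y\<^sup>2 * y\<^sup>2 / 120))"
    by (simp add: eval_nat_numeral field_simps)
  also have "\<dots> \<le> y * (1 - y\<^sup>2 / 2)"
  proof (rule mult_left_mono)
    define z where "z = y\<^sup>2"
    have z: "0 \<le> z" "z \<le> 2337 / 10000" using y2 by (auto simp: z_def)
    have "(1 - z / 2) - (1 - 35 / 100 * z) * (1 - z / 6 + z * z / 120) =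
        z * (1 / 60 - z * (1 / 15) + z * z * (35 / 12000))"
      by (simp add: algebra_simps)
    also have "\<dots> \<ge> 0"
      using z by (intro mult_nonneg_nonneg) auto
    finally show "(1 - 35 / 100 * y\<^sup>2) * (1 - y\<^sup>2 / 6 + y\<^sup>2 * y\<^sup>2 / 120) \<le> 1 - y\<^sup>2 / 2"
      by (simp add: z_def)
  qed (use y in simp)
  also have "\<dots> \<le> y * cos y"
    by (rule mult_left_mono[OF co]) (use y in simp)
  finally have "(1 - 35 / 100 * y\<^sup>2) * sin y \<le> y * cos y" .
  then have "(1 - 35 / 100 * y\<^sup>2) / y \<le> cos y / sin y"
    using s0 y by (simp add: divide_simps mult_ac)
  moreover have "(1 - 35 / 100 * y\<^sup>2) / y = 1 / y - 35 / 100 * y"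
    using y by (simp add: field_simps power2_eq_square)
  ultimately show ?thesis
    by (simp add: cot_def)
qed

lemma cot_upper_bound:
  assumes y: "0 < y" "y < pi / 2"
  shows "cot y \<le> 1 / y"
proof -
  define f :: "real \<Rightarrow> real" where "f = (\<lambda>x. sin x - x * cos x)"
  have "f 0 \<le> f y"
  proof (rule DERIV_nonneg_imp_nondecreasing[of 0 y f])
    fix x assume x: "0 \<le> x" "x \<le> y"
    have "(f has_real_derivative x * sin x) (at x)"
      unfolding f_def by (auto intro!: derivative_eq_intros)
    moreover have "x * sin x \<ge> 0"
      using x y by (intro mult_nonneg_nonneg sin_ge_zero) auto
    ultimately show "\<exists>d. (f has_real_derivative d) (at x) \<and> 0 \<le> d"
      by blast
  qed (use y in simp)
  then have "0 \<le> sin y - y * cos y"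
    by (simp add: f_def)
  moreover have "0 < sin y"
    using y by (intro sin_gt_zero) auto
  ultimately show ?thesis
    using y by (simp add: cot_def divide_simps mult.commute)
qed

lemma sigma_coeff_step_up:
  assumes k: "k \<ge> 10" and j: "1 \<le> M" "M \<le> j"
  shows "sigma_coeff k (Suc j) \<le> (1 + 9 / 8 * (1 / 2) ^ (k - 1)) * (1 + 1 / real M) ^ k * sigma_coeff k j"
proof -
  let ?d = "9 / 8 * (1 / 2) ^ (k - 1) :: real"
  have "sigma_coeff k (Suc j) \<le> (1 + ?d) * real (Suc j) ^ k"
    by (rule sigma_coeff_bounds(2)[OF k])
  also have "real (Suc j) = (1 + 1 / real j) * real j"
    using j by (simp add: field_simps)
  also have "((1 + 1 / real j) * real j) ^ k = (1 + 1 / real j) ^ k * real j ^ k"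
    by (rule power_mult_distrib)
  also have "(1 + ?d) * ((1 + 1 / real j) ^ k * real j ^ k) \<le> (1 + ?d) * ((1 + 1 / real M) ^ k * sigma_coeff k j)"
    using j sigma_coeff_bounds(1)[OF k, of j]
    by (intro mult_left_mono mult_mono power_mono add_left_mono divide_left_mono) auto
  finally show ?thesis by (simp only: mult.assoc)
qed

lemma sigma_coeff_step_down:
  assumes k: "k \<ge> 10" and i: "i < m"
  shows "sigma_coeff k i \<le> (1 + 9 / 8 * (1 / 2) ^ (k - 1)) * (1 - 1 / real m) ^ k * sigma_coeff k (Suc i)"
proof -
  let ?d = "9 / 8 * (1 / 2) ^ (k - 1) :: real"
  have "sigma_coeff k i \<le> (1 + ?d) * real i ^ k"
    by (rule sigma_coeff_bounds(2)[OF k])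
  also have "real i = (1 - 1 / real (Suc i)) * real (Suc i)"
    by (simp add: field_simps)
  also have "((1 - 1 / real (Suc i)) * real (Suc i)) ^ k = (1 - 1 / real (Suc i)) ^ k * real (Suc i) ^ k"
    by (rule power_mult_distrib)
  also have "(1 + ?d) * ((1 - 1 / real (Suc i)) ^ k * real (Suc i) ^ k) \<le>
      (1 + ?d) * ((1 - 1 / real m) ^ k * sigma_coeff k (Suc i))"
  proof (intro mult_left_mono mult_mono power_mono)
    show "1 - 1 / real (Suc i) \<le> 1 - 1 / real m"
      using i by (intro diff_left_mono divide_left_mono) auto
    show "real (Suc i) ^ k \<le> sigma_coeff k (Suc i)"
      by (rule sigma_coeff_bounds(1)[OF k])
    show "0 \<le> (1 - 1 / real m) ^ k"
      using i by (intro zero_le_power) (simp add: divide_simps)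
  qed (simp_all add: divide_simps)
  finally show ?thesis by (simp only: mult.assoc)
qed

text \<open>A rational bound for numerical use: the quadratic Taylor polynomial at x/N raised to the
  N-th power, with N chosen large enough for the accuracy needed.\<close>

lemma exp_minus_upper_bound:
  fixes x :: real
  assumes "x \<ge> 0" "N \<ge> 1"
  shows "exp (- x) \<le> 1 / (1 + x / real N + (x / real N)\<^sup>2 / 2) ^ N"
proof -
  have "(1 + x / real N + (x / real N)\<^sup>2 / 2) ^ N \<le> exp (x / real N) ^ N"
    using assms by (intro power_mono exp_lower_Taylor_quadratic) (auto intro!: add_nonneg_nonneg)
  also have "\<dots> = exp x"
    using assms by (simp flip: exp_of_nat_mult)
  finally have "1 / exp x \<le> 1 / (1 + x / real N + (x / real N)\<^sup>2 / 2) ^ N"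
    using assms by (intro divide_left_mono) (auto intro!: mult_pos_pos zero_less_power add_pos_nonneg)
  then show ?thesis by (simp add: exp_minus inverse_eq_divide)
qed

lemma one_minus_le_exp:
  fixes x :: real
  assumes "0 \<le> x" "x \<le> 1"
  shows "1 - x \<le> exp (- x - x\<^sup>2 / 2)"
proof (cases "x = 1")
  case False
  define g where "g = (\<lambda>x :: real. ln (1 - x) + x + x\<^sup>2 / 2)"
  have "g x \<le> g 0"
  proof (rule DERIV_nonpos_imp_nonincreasing[of 0 x g])
    fix y assume y: "0 \<le> y" "y \<le> x"
    have "(g has_real_derivative - (y\<^sup>2) / (1 - y)) (at y)"
      unfolding g_def using y assms False
      by (auto intro!: derivative_eq_intros simp: field_simps power2_eq_square)
    moreover have "- (y\<^sup>2) / (1 - y) \<le> 0"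
      using y assms False by (simp add: divide_nonpos_nonneg)
    ultimately show "\<exists>d. (g has_real_derivative d) (at y) \<and> d \<le> 0" by blast
  qed (use assms in simp)
  then have "ln (1 - x) \<le> - x - x\<^sup>2 / 2"
    by (simp add: g_def)
  then have "exp (ln (1 - x)) \<le> exp (- x - x\<^sup>2 / 2)" by simp
  then show ?thesis using assms False by simp
qed simp

lemma one_plus_le_exp_quadratic:
  fixes x c :: real
  assumes "0 \<le> x" "0 \<le> c" "2 * c * (1 + x) \<le> 1"
  shows "1 + x \<le> exp (x - c * x\<^sup>2)"
proof -
  define g where "g = (\<lambda>x :: real. x - c * x\<^sup>2 - ln (1 + x))"
  have "g 0 \<le> g x"
  proof (rule DERIV_nonneg_imp_nondecreasing[of 0 x g])
    fix y assume y: "0 \<le> y" "y \<le> x"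
    have "(g has_real_derivative y * (1 - 2 * c * (1 + y)) / (1 + y)) (at y)"
      unfolding g_def using y
      by (auto intro!: derivative_eq_intros simp: field_simps power2_eq_square)
    moreover have "2 * c * (1 + y) \<le> 2 * c * (1 + x)"
      using y assms by (intro mult_left_mono) auto
    then have "0 \<le> y * (1 - 2 * c * (1 + y)) / (1 + y)"
      using y assms by (intro divide_nonneg_nonneg mult_nonneg_nonneg) auto
    ultimately show "\<exists>d. (g has_real_derivative d) (at y) \<and> 0 \<le> d" by blast
  qed (use assms in simp)
  then have "ln (1 + x) \<le> x - c * x\<^sup>2"
    by (simp add: g_def)
  then have "exp (ln (1 + x)) \<le> exp (x - c * x\<^sup>2)" by simp
  then show ?thesis using assms by simp
qed

lemma exp_power_real: "exp (y :: real) ^ k = exp (real k * y)"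
  by (simp add: exp_of_nat_mult)

lemma one_plus_inverse_power_le:
  assumes "M \<ge> 2"
  shows "(1 + 1 / real M) ^ k \<le> exp (real k * (1 / real M - 373 / 1000 / (real M)\<^sup>2))"
proof -
  have "1 + 1 / real M \<le> exp (1 / real M - 373 / 1000 * (1 / real M)\<^sup>2)"
  proof (cases "M = 2")
    \<comment> \<open>For M = 2 the quadratic inequality would allow only constants up to 1/3, so ln
      (3/2) < 0.40675 = 1/2 - 0.373/4 is checked numerically. For M at least 3 it allows constants
      up to 3/8.\<close>
    case True
    have "(1 + 40675 / 100000 / real 8 + (40675 / 100000 / real 8)\<^sup>2 / 2) ^ 8 \<le> exp (40675 / 100000 / real 8 :: real) ^ 8"
      by (intro power_mono exp_lower_Taylor_quadratic) auto
    moreover have "3 / 2 \<le> (1 + 40675 / 100000 / real 8 + (40675 / 100000 / real 8)\<^sup>2 / 2 :: real) ^ 8"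
      by (simp add: power2_eq_square eval_nat_numeral)
    moreover have "exp (40675 / 100000 / real 8 :: real) ^ 8 = exp (40675 / 100000)"
      by (simp add: exp_power_real)
    ultimately have "3 / 2 \<le> exp (40675 / 100000 :: real)" by linarith
    then show ?thesis using True by (simp add: power2_eq_square)
  next
    case False
    then have "M \<ge> 3" using assms by simp
    then show ?thesis by (intro one_plus_le_exp_quadratic) (auto simp: field_simps)
  qed
  then have "(1 + 1 / real M) ^ k \<le> exp (1 / real M - 373 / 1000 * (1 / real M)\<^sup>2) ^ k"
    by (intro power_mono) auto
  then show ?thesis
    by (simp only: exp_power_real power_divide) simp
qed

text \<open>The case m = 1 forces the smaller constant 3/10, since 1 - ln 2 is only about
  0.307.\<close>

lemma one_plus_inverse_power_le':
  assumes "m \<ge> 1"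
  shows "(1 + 1 / real m) ^ k \<le> exp (real k * (1 / real m - 3 / 10 / (real m)\<^sup>2))"
proof (cases "m = 1")
  case True
  have "(2 :: real) = exp (ln 2)" by simp
  also have "\<dots> \<le> exp (7 / 10)"
    using ln2_le_25_over_36 by (subst exp_le_cancel_iff) simp
  finally have "(2 :: real) ^ k \<le> exp (7 / 10) ^ k"
    by (intro power_mono) auto
  then show ?thesis using True by (simp add: exp_power_real)
next
  case False
  then have "m \<ge> 2" using assms by simp
  then have "1 + 1 / real m \<le> exp (1 / real m - 3 / 10 * (1 / real m)\<^sup>2)"
    by (intro one_plus_le_exp_quadratic) (auto simp: field_simps)
  then have "(1 + 1 / real m) ^ k \<le> exp (1 / real m - 3 / 10 * (1 / real m)\<^sup>2) ^ k"
    by (intro power_mono) auto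
  then show ?thesis
    by (simp only: exp_power_real power_divide) simp
qed

lemma two_pi_cot_height: "2 * pi * cot_height k m = pi * cot (real m * pi / real (k + 1))"
  by (simp add: cot_height_def)

lemma two_pi_cot_height_upper:
  assumes "1 \<le> m" "2 * m < k + 1"
  shows "2 * pi * cot_height k m \<le> real (k + 1) / real m"
proof -
  have "real m * 2 < 1 + real k"
    using assms by linarith
  then have "pi * (real m * 2) < pi * (1 + real k)"
    by simp
  then have "cot (real m * pi / real (k + 1)) \<le> 1 / (real m * pi / real (k + 1))"
    using assms by (intro cot_upper_bound) (auto simp: field_simps)
  then have "pi * cot (real m * pi / real (k + 1)) \<le> pi * (1 / (real m * pi / real (k + 1)))"
    by (rule mult_left_mono) simp
  then show ?thesis
    unfolding two_pi_cot_height by simp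
qed

lemma two_pi_cot_height_lower:
  assumes "1 \<le> m" "13 * m \<le> 2 * (k + 1)"
  shows "real (k + 1) / real m - 346 / 100 * (real m / real (k + 1)) \<le> 2 * pi * cot_height k m"
proof -
  define y where "y = real m * pi / real (k + 1)"
  have y0: "y > 0" using assms by (simp add: y_def)
  have "13 * real m \<le> 2 * real (k + 1)"
    using of_nat_mono[OF assms(2), where 'a = real] by simp
  then have "real m / real (k + 1) \<le> 2 / 13"
    by (simp add: field_simps)
  then have "real m / real (k + 1) * pi \<le> 2 / 13 * (31415927 / 10000000)"
    using pi_approx by (intro mult_mono) auto
  moreover have "y = real m / real (k + 1) * pi"
    by (simp add: y_def)
  ultimately have "y \<le> 48333 / 100000"
    by linarith
  then have "1 / y - 35 / 100 * y \<le> cot y"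
    using y0 by (intro cot_lower_bound) auto
  then have "pi * (1 / y - 35 / 100 * y) \<le> pi * cot y"
    by (rule mult_left_mono) simp
  moreover have "pi * (1 / y - 35 / 100 * y) = real (k + 1) / real m - 35 / 100 * (pi * pi) * (real m / real (k + 1))"
    unfolding y_def right_diff_distrib using assms by simp
  moreover have "pi * pi \<le> 31416 / 10000 * (31416 / 10000)"
    using pi_approx by (intro mult_mono) auto
  then have "35 / 100 * (pi * pi) * (real m / real (k + 1)) \<le> 346 / 100 * (real m / real (k + 1))"
    by (intro mult_right_mono) auto
  ultimately show ?thesis
    unfolding two_pi_cot_height y_def by linarith
qed

section \<open>Ratios of consecutive terms near the nodes\<close>

lemma delta_bound:
  assumes "k \<ge> 12"
  shows "9 / 8 * (1 / 2 :: real) ^ (k - 1) \<le> 1 / 1000"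
proof -
  have "(1 / 2 :: real) ^ (k - 1) \<le> (1 / 2) ^ 11"
    using assms by (intro power_decreasing) auto
  then show ?thesis by (simp add: eval_nat_numeral)
qed

lemma cot_height_index_bounds:
  fixes m k :: nat
  assumes "1 \<le> m" "12 \<le> k" "11 * m\<^sup>2 \<le> k"
  shows "13 * m \<le> 2 * (k + 1)" "13 * (m + 1) \<le> 2 * (k + 1)" "2 * (m + 1) < k + 1"
proof -
  have "m \<le> m * m" by simp
  then have "11 * m \<le> k" using assms(3) unfolding power2_eq_square by linarith
  then show "13 * m \<le> 2 * (k + 1)" "13 * (m + 1) \<le> 2 * (k + 1)" "2 * (m + 1) < k + 1"
    using assms(1,2) by (cases "m = 1"; simp)+
qed

text \<open>The linear parts k/m in the exponents of \<open>(1 - 1/m) ^ k\<close> and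
  \<open>exp (2 * pi * t)\<close> cancel, which is why \<open>one_minus_le_exp\<close> keeps the
  quadratic term. What remains is \<open>1/m - k / (2 * m^2)\<close>, at most -5 for m at least 2;
  for m = 1 the first factor is zero.\<close>

lemma lower_ratio_bound:
  assumes m: "1 \<le> m" "12 \<le> k" "11 * m\<^sup>2 \<le> k" and t: "t \<le> cot_height k m"
  shows "(1 + 9 / 8 * (1 / 2) ^ (k - 1)) * (1 - 1 / real m) ^ k * exp (2 * pi * t) \<le> 72 / 10000"
proof (cases "m = 1")
  case True
  then show ?thesis using m by (simp add: power_0_left)
next
  case False
  then have m2: "m \<ge> 2" using m by simp
  have "1 - 1 / real m \<le> exp (- (1 / real m) - (1 / real m)\<^sup>2 / 2)"
    using m by (intro one_minus_le_exp) auto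
  then have "(1 - 1 / real m) ^ k \<le> exp (- (1 / real m) - (1 / real m)\<^sup>2 / 2) ^ k"
    using m by (intro power_mono) auto
  also have "\<dots> = exp (real k * (- (1 / real m) - (1 / real m)\<^sup>2 / 2))"
    by (rule exp_power_real)
  finally have p: "(1 - 1 / real m) ^ k \<le> exp (real k * (- (1 / real m) - (1 / real m)\<^sup>2 / 2))" .
  have "2 * pi * t \<le> 2 * pi * cot_height k m"
    using t by simp
  also have "\<dots> \<le> real (k + 1) / real m"
    by (rule two_pi_cot_height_upper) (use cot_height_index_bounds[OF m] m in auto)
  finally have "exp (2 * pi * t) \<le> exp (real (k + 1) / real m)" by simp
  then have "(1 - 1 / real m) ^ k * exp (2 * pi * t) \<le>
      exp (real k * (- (1 / real m) - (1 / real m)\<^sup>2 / 2)) * exp (real (k + 1) / real m)"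
    using m by (intro mult_mono p) auto
  also have "\<dots> = exp (1 / real m - real k / (real m)\<^sup>2 / 2)"
  proof -
    have "real k * (- (1 / real m) - (1 / real m)\<^sup>2 / 2) + real (k + 1) / real m =
        1 / real m - real k / (real m)\<^sup>2 / 2"
      by (simp add: add_divide_distrib right_diff_distrib power_divide)
    then show ?thesis by (simp only: exp_add[symmetric])
  qed
  also have "\<dots> \<le> exp (- 5)"
  proof -
    have "1 / real m \<le> 1 / 2"
      using m2 by (simp add: divide_simps)
    moreover have "11 \<le> real k / (real m)\<^sup>2"
      using of_nat_mono[OF m(3), where 'a = real] m by (simp add: pos_le_divide_eq)
    ultimately show ?thesis by simp
  qed
  also have "\<dots> \<le> 1 / (1 + 5 / real 20 + (5 / real 20)\<^sup>2 / 2) ^ 20"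
    by (rule exp_minus_upper_bound) auto
  also have "\<dots> \<le> 71 / 10000"
    by (simp add: power2_eq_square power_divide)
  finally have *: "(1 - 1 / real m) ^ k * exp (2 * pi * t) \<le> 71 / 10000" .
  have "(1 + 9 / 8 * (1 / 2) ^ (k - 1)) * ((1 - 1 / real m) ^ k * exp (2 * pi * t)) \<le> (1 + 1 / 1000) * (71 / 10000)"
    using delta_bound[OF m(2)] m by (intro mult_mono * add_left_mono mult_nonneg_nonneg) auto
  then show ?thesis by (simp add: mult.assoc)
qed

text \<open>After cancellation of k/m the exponent is at most
  \<open>- 0.3 * k / m^2 - 1/m + R\<close>, where R is the loss in the lower bound for the
  cotangent. From \<open>k \<ge> 11 * m^2\<close> one gets R at most 1/m, so the exponent is at most
  -3.3.\<close>

lemma upper_ratio_bound_at_node: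
  assumes m: "1 \<le> m" "12 \<le> k" "11 * m\<^sup>2 \<le> k"
  shows "(1 + 9 / 8 * (1 / 2) ^ (k - 1)) * (1 + 1 / real m) ^ k * exp (- 2 * pi * cot_height k m) \<le> 4 / 100"
proof -
  have m0: "real m > 0" using m by simp
  have lo: "real (k + 1) / real m - 346 / 100 * (real m / real (k + 1)) \<le> 2 * pi * cot_height k m"
    by (rule two_pi_cot_height_lower) (use cot_height_index_bounds[OF m] m in auto)
  have km: "11 * (real m)\<^sup>2 \<le> real k"
    using of_nat_mono[OF m(3), where 'a = real] by simp
  then have q: "11 \<le> real k / (real m)\<^sup>2"
    using m0 by (simp add: pos_le_divide_eq)
  have R: "346 / 100 * (real m / real (k + 1)) \<le> 1 / real m"
  proof -
    have "346 / 100 * (real m * real m) \<le> real (k + 1)"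
      using km by (simp add: power2_eq_square)
    then show ?thesis using m0 by (simp add: field_simps)
  qed
  have kM: "real (k + 1) / real m = real k * (1 / real m) + 1 / real m"
    by (simp add: add_divide_distrib)
  have "real k * (1 / real m - 3 / 10 / (real m)\<^sup>2) = real k * (1 / real m) - 3 / 10 * (real k / (real m)\<^sup>2)"
    by (simp add: right_diff_distrib)
  then have "real k * (1 / real m - 3 / 10 / (real m)\<^sup>2) + - 2 * pi * cot_height k m \<le> - (33 / 10)"
    using lo q R kM by linarith
  then have "exp (real k * (1 / real m - 3 / 10 / (real m)\<^sup>2)) * exp (- 2 * pi * cot_height k m) \<le> exp (- (33 / 10))"
    by (simp flip: exp_add)
  then have "(1 + 1 / real m) ^ k * exp (- 2 * pi * cot_height k m) \<le> exp (- (33 / 10))"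
    by (rule order_trans[rotated]) (intro mult_right_mono one_plus_inverse_power_le' m(1) exp_ge_zero)
  also have "\<dots> \<le> 1 / (1 + 33 / 10 / real 10 + (33 / 10 / real 10)\<^sup>2 / 2) ^ 10"
    by (rule exp_minus_upper_bound) auto
  also have "\<dots> \<le> 39 / 1000"
    by (simp add: power2_eq_square power_divide)
  finally have *: "(1 + 1 / real m) ^ k * exp (- 2 * pi * cot_height k m) \<le> 39 / 1000" .
  have "(1 + 9 / 8 * (1 / 2) ^ (k - 1)) * ((1 + 1 / real m) ^ k * exp (- 2 * pi * cot_height k m)) \<le> (1 + 1 / 1000) * (39 / 1000)"
    using delta_bound[OF m(2)] by (intro mult_mono * add_left_mono mult_nonneg_nonneg) auto
  then show ?thesis by (simp add: mult.assoc)
qed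

text \<open>The constants 1.086 and 1.967 come from the extreme case M = 2, k = 12, where they are
  almost attained. For M at least 3 the hypothesis gives \<open>k \<ge> 4.88 * M^2\<close>, which
  leaves ample room.\<close>

lemma upper_ratio_bounds:
  assumes m: "1 \<le> m" "12 \<le> k" "11 * m\<^sup>2 \<le> k" and M: "M = m + 1" and t: "cot_height k M \<le> t"
  shows "(1 + 9 / 8 * (1 / 2) ^ (k - 1)) * (1 + 1 / real M) ^ k * exp (- 2 * pi * t) \<le> 35 / 100"
    and "(1 + 9 / 8 * (1 / 2) ^ (k - 1)) * (1 + 1 / real (M + 1)) ^ k * exp (- 2 * pi * t) \<le> 145 / 1000"
proof -
  have M2: "M \<ge> 2" using m M by simp
  have M0: "real M > 0" using M2 by simp
  define R where "R = 346 / 100 * (real M / real (k + 1))"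
  have lo: "real (k + 1) / real M - R \<le> 2 * pi * cot_height k M"
    unfolding R_def M by (rule two_pi_cot_height_lower) (use cot_height_index_bounds[OF m] m in auto)
  have km: "11 * (real M - 1)\<^sup>2 \<le> real k"
    using of_nat_mono[OF m(3), where 'a = real] M by simp
  have exps: "- (373 / 1000 * (real k / (real M)\<^sup>2)) - 1 / real M + R \<le> - (1086 / 1000) \<and>
      - (real k / (real M * real (M + 1))) - 1 / real M + R \<le> - (1967 / 1000)"
  proof (cases "M = 2")
    case True
    have "R \<le> 346 / 100 * (2 / 13)"
      using m(2) True unfolding R_def by (intro mult_left_mono) (auto simp: divide_simps)
    then show ?thesis using True m(2) by simp
  next
    case False
    then have M3: "real M \<ge> 3" using M2 by linarith
    have "4 / 9 * (real M)\<^sup>2 \<le> (real M - 1)\<^sup>2"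
      using power_mono[of "2 / 3 * real M" "real M - 1" 2] M3 by (simp add: power_mult_distrib power_divide)
    then have k1: "488 / 100 * (real M)\<^sup>2 \<le> real k"
      using km by simp
    then have "488 / 100 \<le> real k / (real M)\<^sup>2"
      using M0 by (simp add: pos_le_divide_eq)
    moreover have "366 / 100 \<le> real k / (real M * real (M + 1))"
    proof -
      have "real M * real (M + 1) \<le> real M * (4 / 3 * real M)"
        using M3 by (intro mult_left_mono) auto
      also have "\<dots> = 4 / 3 * (real M)\<^sup>2"
        by (simp add: power2_eq_square)
      finally have "366 / 100 * (real M * real (M + 1)) \<le> real k"
        using k1 by linarith
      then show ?thesis using M0 by (simp add: pos_le_divide_eq)
    qed
    moreover have "R \<le> 1 / real M"
    proof -
      have "346 / 100 * (real M * real M) \<le> real (k + 1)"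
        using k1 by (simp add: power2_eq_square)
      then show ?thesis using M0 by (simp add: R_def field_simps)
    qed
    ultimately show ?thesis by linarith
  qed
  have tt: "- 2 * pi * t \<le> - (real (k + 1) / real M) + R"
  proof -
    have "2 * pi * cot_height k M \<le> 2 * pi * t" using t by simp
    then show ?thesis using lo by linarith
  qed
  have kM: "real (k + 1) / real M = real k * (1 / real M) + 1 / real M"
    by (simp add: add_divide_distrib)
  have "real k * (1 / real M - 373 / 1000 / (real M)\<^sup>2) = real k * (1 / real M) - 373 / 1000 * (real k / (real M)\<^sup>2)"
    by (simp add: right_diff_distrib)
  then have "real k * (1 / real M - 373 / 1000 / (real M)\<^sup>2) + - 2 * pi * t \<le> - (1086 / 1000)"
    using exps tt kM by linarith
  then have "exp (real k * (1 / real M - 373 / 1000 / (real M)\<^sup>2)) * exp (- 2 * pi * t) \<le> exp (- (1086 / 1000))"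
    by (simp flip: exp_add)
  then have "(1 + 1 / real M) ^ k * exp (- 2 * pi * t) \<le> exp (- (1086 / 1000))"
    by (rule order_trans[rotated]) (intro mult_right_mono one_plus_inverse_power_le M2 exp_ge_zero)
  also have "\<dots> \<le> 1 / (1 + 1086 / 1000 / real 10 + (1086 / 1000 / real 10)\<^sup>2 / 2) ^ 10"
    by (rule exp_minus_upper_bound) auto
  also have "\<dots> \<le> 34 / 100"
    by (simp add: power2_eq_square power_divide)
  finally have *: "(1 + 1 / real M) ^ k * exp (- 2 * pi * t) \<le> 34 / 100" .
  have "(1 + 9 / 8 * (1 / 2) ^ (k - 1)) * ((1 + 1 / real M) ^ k * exp (- 2 * pi * t)) \<le> (1 + 1 / 1000) * (34 / 100)"
    using delta_bound[OF m(2)] by (intro mult_mono * add_left_mono mult_nonneg_nonneg) auto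
  then show "(1 + 9 / 8 * (1 / 2) ^ (k - 1)) * (1 + 1 / real M) ^ k * exp (- 2 * pi * t) \<le> 35 / 100"
    by (simp add: mult.assoc)
  have "1 + 1 / real (M + 1) \<le> exp (1 / real (M + 1))"
    by (rule exp_ge_add_one_self)
  then have "(1 + 1 / real (M + 1)) ^ k \<le> exp (1 / real (M + 1)) ^ k"
    by (intro power_mono) auto
  then have p: "(1 + 1 / real (M + 1)) ^ k \<le> exp (real k * (1 / real (M + 1)))"
    by (simp only: exp_power_real)
  have "real k * (1 / real (M + 1)) = real k * (1 / real M) - real k / (real M * real (M + 1))"
  proof -
    have "x * (1 / (a + 1)) = x * (1 / a) - x / (a * (a + 1))" if "0 < a" "0 < a + 1" for a x :: real
      using that by (simp add: divide_simps) (simp add: algebra_simps)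
    from this[of "real M" "real k"] show ?thesis using M0 by (simp add: add.commute)
  qed
  then have "real k * (1 / real (M + 1)) + - 2 * pi * t \<le> - (1967 / 1000)"
    using exps tt kM by linarith
  then have "exp (real k * (1 / real (M + 1))) * exp (- 2 * pi * t) \<le> exp (- (1967 / 1000))"
    by (simp only: exp_le_cancel_iff flip: exp_add)
  then have "(1 + 1 / real (M + 1)) ^ k * exp (- 2 * pi * t) \<le> exp (- (1967 / 1000))"
    by (rule order_trans[rotated]) (intro mult_right_mono p exp_ge_zero)
  also have "\<dots> \<le> 1 / (1 + 1967 / 1000 / real 10 + (1967 / 1000 / real 10)\<^sup>2 / 2) ^ 10"
    by (rule exp_minus_upper_bound) auto
  also have "\<dots> \<le> 144 / 1000"
    by (simp add: power2_eq_square power_divide)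
  finally have *: "(1 + 1 / real (M + 1)) ^ k * exp (- 2 * pi * t) \<le> 144 / 1000" .
  have "(1 + 9 / 8 * (1 / 2) ^ (k - 1)) * ((1 + 1 / real (M + 1)) ^ k * exp (- 2 * pi * t)) \<le> (1 + 1 / 1000) * (144 / 1000)"
    using delta_bound[OF m(2)] by (intro mult_mono * add_left_mono mult_nonneg_nonneg) auto
  then show "(1 + 9 / 8 * (1 / 2) ^ (k - 1)) * (1 + 1 / real (M + 1)) ^ k * exp (- 2 * pi * t) \<le> 145 / 1000"
    by (simp add: mult.assoc)
qed

section \<open>Domination of the Fourier series by one or two terms\<close>

abbreviation qterm :: "nat \<Rightarrow> real \<Rightarrow> nat \<Rightarrow> real" where
  "qterm k t j \<equiv> sigma_coeff k j * exp (- 2 * pi * t) ^ j"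

lemma sigma_coeff_pos: "k \<ge> 10 \<Longrightarrow> j \<ge> 1 \<Longrightarrow> sigma_coeff k j > 0"
  using sigma_coeff_bounds(1)[of k j] by (auto intro: less_le_trans[rotated])

lemma sigma_coeff_nonneg [simp]: "sigma_coeff k j \<ge> 0"
  by (simp add: sigma_coeff_def)

lemma qterm_nonneg: "qterm k t j \<ge> 0"
  by simp

lemma qterm_up:
  assumes k: "k \<ge> 10" and j: "1 \<le> M" "M \<le> j"
    and r: "(1 + 9 / 8 * (1 / 2) ^ (k - 1)) * (1 + 1 / real M) ^ k * exp (- 2 * pi * t) \<le> \<rho>"
  shows "qterm k t (Suc j) \<le> \<rho> * qterm k t j"
proof -
  define E where "E = exp (- 2 * pi * t)"
  have "sigma_coeff k (Suc j) * E ^ Suc j \<le>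
      (1 + 9 / 8 * (1 / 2) ^ (k - 1)) * (1 + 1 / real M) ^ k * sigma_coeff k j * E ^ Suc j"
    by (intro mult_right_mono sigma_coeff_step_up k j) (simp add: E_def)
  also have "\<dots> = (1 + 9 / 8 * (1 / 2) ^ (k - 1)) * (1 + 1 / real M) ^ k * E * (sigma_coeff k j * E ^ j)"
    by simp
  also have "\<dots> \<le> \<rho> * (sigma_coeff k j * E ^ j)"
    unfolding E_def by (intro mult_right_mono r qterm_nonneg)
  finally show ?thesis by (simp only: E_def)
qed

lemma qterm_down:
  assumes k: "k \<ge> 10" and i: "i < m"
    and r: "(1 + 9 / 8 * (1 / 2) ^ (k - 1)) * (1 - 1 / real m) ^ k * exp (2 * pi * t) \<le> \<rho>"
  shows "qterm k t i \<le> \<rho> * qterm k t (Suc i)"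
proof -
  define E where "E = exp (- 2 * pi * t)"
  have E: "exp (2 * pi * t) * E = 1" "E > 0"
    by (simp_all add: E_def flip: exp_add)
  have "sigma_coeff k i * E ^ i \<le>
      (1 + 9 / 8 * (1 / 2) ^ (k - 1)) * (1 - 1 / real m) ^ k * sigma_coeff k (Suc i) * E ^ i"
    by (intro mult_right_mono sigma_coeff_step_down k i) (use E in simp)
  also have "\<dots> = (1 + 9 / 8 * (1 / 2) ^ (k - 1)) * (1 - 1 / real m) ^ k * sigma_coeff k (Suc i) *
      (exp (2 * pi * t) * E) * E ^ i"
    unfolding E by simp
  also have "\<dots> = (1 + 9 / 8 * (1 / 2) ^ (k - 1)) * (1 - 1 / real m) ^ k * exp (2 * pi * t) *
      (sigma_coeff k (Suc i) * E ^ Suc i)"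
    by simp
  also have "\<dots> \<le> \<rho> * (sigma_coeff k (Suc i) * E ^ Suc i)"
    unfolding E_def by (intro mult_right_mono r qterm_nonneg)
  finally show ?thesis by (simp only: E_def)
qed

lemma qsum_qterm: "qsum (\<lambda>j. p j * sigma_coeff k j) t = (\<Sum>j. (-1) ^ j * p j * qterm k t j)"
proof -
  have "(- exp (- 2 * pi * t)) ^ j = (-1) ^ j * exp (- 2 * pi * t) ^ j" for j
    by (rule power_minus)
  then show ?thesis
    unfolding qsum_def by (simp only: mult_ac)
qed

lemma sign_at_node_series:
  assumes m: "1 \<le> m" "12 \<le> k" "11 * m\<^sup>2 \<le> k"
  shows "(-1) ^ m * qsum (sigma_coeff k) (cot_height k m) > 0"
proof -
  define t where "t = cot_height k m"
  define u where "u = (\<lambda>j. (-1) ^ j * qterm k t j)"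
  have k: "k \<ge> 10" using m by simp
  have au: "\<bar>u j\<bar> = qterm k t j" for j
    unfolding u_def abs_mult power_abs by simp
  note lo = lower_ratio_bound[OF m order_refl, folded t_def]
  note up = upper_ratio_bound_at_node[OF m, folded t_def]
  have dn: "\<bar>u i\<bar> \<le> 72 / 10000 * \<bar>u (Suc i)\<bar>" if "i < m" for i
    unfolding au by (rule qterm_down[OF k that lo])
  have up': "\<bar>u (Suc i)\<bar> \<le> 4 / 100 * \<bar>u i\<bar>" if "m \<le> i" for i
    unfolding au by (rule qterm_up[OF k m(1) that up])
  have "\<bar>suminf u - (\<Sum>i=m..m. u i)\<bar> \<le> 1 / 100 * qterm k t m + 5 / 100 * qterm k t m"
  proof (rule alternating_dominant_sum[where a = "72 / 10000" and c = "4 / 100"])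
    assume "m \<ge> 1"
    then have "\<bar>u (m - 1)\<bar> \<le> 72 / 10000 * qterm k t m"
      using dn[of "m - 1"] by (simp add: au)
    then show "\<bar>u (m - 1)\<bar> / (1 - 72 / 10000) \<le> 1 / 100 * qterm k t m"
      using qterm_nonneg[of k m t] by simp
  next
    show "\<bar>u (Suc m)\<bar> / (1 - 4 / 100) \<le> 5 / 100 * qterm k t m"
    proof -
      have "x / (1 - 4 / 100) \<le> 5 / 100 * y" if "x \<le> 4 / 100 * y" "y \<ge> 0" for x y :: real
        using that by simp
      from this[OF up'[OF order_refl]] show ?thesis by (simp only: au qterm_nonneg)
    qed
  qed (use dn up' qterm_nonneg[of k m t] in auto)
  then have d: "\<bar>suminf u - u m\<bar> \<le> 6 / 100 * qterm k t m"
    by simp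
  have "(-1) ^ m * u m = qterm k t m"
    by (simp add: u_def flip: mult.assoc power_add)
  moreover have "\<bar>(-1) ^ m * suminf u - (-1) ^ m * u m\<bar> = \<bar>suminf u - u m\<bar>"
    by (simp add: abs_mult power_abs flip: right_diff_distrib)
  moreover have "qterm k t m > 0"
    using sigma_coeff_pos[OF k m(1)] by simp
  ultimately have "(-1) ^ m * suminf u > 0"
    using d by linarith
  moreover have "suminf u = qsum (sigma_coeff k) t"
    using qsum_qterm[of "\<lambda>_. 1" k t] by (simp add: u_def)
  ultimately show ?thesis by (simp add: t_def)
qed

text \<open>
  Up to a non-zero factor the sum is the derivative of \<open>exp (2 * pi * (m + 1/20) * t) * F t\<close>. The
  exponent \<open>m + 1/20\<close> leaves a positive weight on the \<open>m\<close>-th term, which absorbs the lower terms near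
  \<open>t\<^sub>m\<close>; it has to stay close to \<open>m\<close> because near \<open>t\<^sub>m\<^sub>+\<^sub>1\<close> the term of index \<open>m + 2\<close> can exceed a
  quarter of the term of index \<open>m + 1\<close>.
\<close>
lemma weighted_sum_q:
  assumes m: "1 \<le> m" "12 \<le> k" "11 * m\<^sup>2 \<le> k"
    and t: "cot_height k (m + 1) \<le> t" "t \<le> cot_height k m"
  defines "u \<equiv> \<lambda>j. (-1) ^ j * (real j - real m - 1 / 20) * qterm k t j"
  shows "(-1) ^ (m + 1) * suminf u > 0"
proof -
  let ?T = "qterm k t"
  have k: "k \<ge> 10" using m by simp
  note T0 = qterm_nonneg[where k = k and t = t]
  have au: "\<bar>u j\<bar> = \<bar>real j - real m - 1 / 20\<bar> * ?T j" for j
    unfolding u_def abs_mult power_abs by simp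
  note lo = lower_ratio_bound[OF m t(2)]
  note up = upper_ratio_bounds[OF m refl t(1)]
  have down: "?T i \<le> 72 / 10000 * ?T (Suc i)" if "i < m" for i
    by (rule qterm_down[OF k that lo])
  have up1: "?T (m + 2) \<le> 35 / 100 * ?T (m + 1)"
    using qterm_up[OF k _ _ up(1), of "m + 1"] by simp
  have up2: "?T (Suc i) \<le> 145 / 1000 * ?T i" if "m + 2 \<le> i" for i
    using qterm_up[OF k _ _ up(2), of i] that by simp
  have Tm: "?T m > 0" "?T (m + 1) > 0"
    using sigma_coeff_pos[OF k, of m] sigma_coeff_pos[OF k, of "m + 1"] m by simp_all
  have dn: "\<bar>u i\<bar> \<le> 1 / 5 * \<bar>u (Suc i)\<bar>" if "i < m" for i
  proof -
    have im: "real i + 1 \<le> real m" using that by linarith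
    have "\<bar>u i\<bar> = (real m + 1 / 20 - real i) * ?T i"
      unfolding au using im by simp
    also have "\<dots> \<le> (real m + 1 / 20 - real i) * (72 / 10000 * ?T (Suc i))"
      using im by (intro mult_left_mono down that) auto
    also have "\<dots> = (72 / 10000 * (real m + 1 / 20 - real i)) * ?T (Suc i)"
      by simp
    \<comment> \<open>The tightest case is i = m - 1, with weights 21/20 and 1/20: 0.0072 * 21/20 =
      0.00756 is below 0.2 * 1/20 = 0.01.\<close>
    also have "\<dots> \<le> (1 / 5 * (real m + 1 / 20 - real (Suc i))) * ?T (Suc i)"
      using im by (intro mult_right_mono T0) auto
    also have "\<dots> = 1 / 5 * \<bar>u (Suc i)\<bar>"
      unfolding au using im by simp
    finally show ?thesis .
  qed
  have up': "\<bar>u (Suc i)\<bar> \<le> 22 / 100 * \<bar>u i\<bar>" if "m + 1 < i" for i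
  proof -
    have im: "real m + 2 \<le> real i" using that by linarith
    have "\<bar>u (Suc i)\<bar> = (real (Suc i) - real m - 1 / 20) * ?T (Suc i)"
      unfolding au using im by simp
    also have "\<dots> \<le> (real (Suc i) - real m - 1 / 20) * (145 / 1000 * ?T i)"
      using im that by (intro mult_left_mono up2) auto
    also have "\<dots> = (145 / 1000 * (real (Suc i) - real m - 1 / 20)) * ?T i"
      by simp
    \<comment> \<open>The tightest case is i = m + 2, with weights 39/20 and 59/20: 0.145 * 59/20 =
      0.42775 is below 0.22 * 39/20 = 0.429.\<close>
    also have "\<dots> \<le> (22 / 100 * (real i - real m - 1 / 20)) * ?T i"
      using im by (intro mult_right_mono T0) auto
    also have "\<dots> = 22 / 100 * \<bar>u i\<bar>"
      unfolding au using im by simp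
    finally show ?thesis .
  qed
  have A: "\<bar>u (m - 1)\<bar> / (1 - 1 / 5) \<le> 1 / 100 * ?T m" if "m \<ge> 1"
  proof -
    have "?T (m - 1) \<le> 72 / 10000 * ?T m"
      using down[of "m - 1"] that by simp
    then show ?thesis
      unfolding au using that Tm(1) by (simp add: of_nat_diff)
  qed
  have B: "\<bar>u (Suc (m + 1))\<bar> / (1 - 22 / 100) \<le> 9 / 10 * ?T (m + 1)"
  proof -
    \<comment> \<open>0.35 * 39/20 / 0.78 = 7/8 stays below 19/20, the weight of the term m + 1.
      With the ratio 0.35 for the whole tail this would fail; hence the second, sharper bound in
      \<open>upper_ratio_bounds\<close>.\<close>
    have "39 / 20 * x / (1 - 22 / 100) \<le> 9 / 10 * y" if "x \<le> 35 / 100 * y" "y > 0" for x y :: real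
      using that by simp
    from this[OF up1 Tm(2)] show ?thesis unfolding au by simp
  qed
  note dom = alternating_dominant_sum[where a = "1 / 5" and c = "22 / 100" and u = u and m = m and l = "m + 1"]
  have "\<bar>suminf u - (\<Sum>i=m..m+1. u i)\<bar> \<le> 1 / 100 * ?T m + 9 / 10 * ?T (m + 1)"
    by (rule dom[OF dn _ _ up' _ _ _ A _ B]) (use Tm in auto)
  moreover have "(\<Sum>i=m..m+1. u i) = u m + u (m + 1)"
    by simp
  ultimately have d: "\<bar>suminf u - (u m + u (m + 1))\<bar> \<le> 1 / 100 * ?T m + 9 / 10 * ?T (m + 1)"
    by (simp only:)
  define s where "s = (-1 :: real) ^ (m + 1)"
  have ss: "s * s = 1" "\<bar>s\<bar> = 1" "(-1 :: real) ^ m = - s"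
    by (simp_all add: s_def power_abs flip: power_mult_distrib)
  have "u m = s * (1 / 20 * ?T m)" "u (m + 1) = s * (19 / 20 * ?T (m + 1))"
    unfolding u_def s_def by simp_all
  then have "s * (u m + u (m + 1)) = (s * s) * (1 / 20 * ?T m + 19 / 20 * ?T (m + 1))"
    by (simp only: distrib_left mult.assoc)
  then have "s * (u m + u (m + 1)) = 1 / 20 * ?T m + 19 / 20 * ?T (m + 1)"
    unfolding ss by simp
  moreover have "\<bar>s * suminf u - s * (u m + u (m + 1))\<bar> = \<bar>suminf u - (u m + u (m + 1))\<bar>"
    unfolding right_diff_distrib[symmetric] abs_mult ss by simp
  ultimately have "s * suminf u > 0"
    using d Tm by linarith
  then show "(-1) ^ (m + 1) * suminf u > 0" by (simp only: s_def)
qed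

lemma no_two_zeros_series:
  assumes m: "1 \<le> m" "12 \<le> k" "11 * m\<^sup>2 \<le> k" and pos: "cot_height k (m + 1) > 0"
    and a: "cot_height k (m + 1) < a" "a < b" "b < cot_height k m"
    and z: "qsum (sigma_coeff k) a = 0" "qsum (sigma_coeff k) b = 0"
  shows False
proof -
  have k: "k \<ge> 10" using m by simp
  define F where "F = qsum (sigma_coeff k)"
  define F1 where "F1 = qsum (\<lambda>j. real j * sigma_coeff k j)"
  define q where "q = real m + 1 / 20"
  define g where "g = (\<lambda>t. (-1) ^ m * (exp (2 * pi * q * t) * F t))"
  have pos': "(-1) ^ (m + 1) * (F1 t - q * F t) > 0"
    if t: "cot_height k (m + 1) \<le> t" "t \<le> cot_height k m" for t
  proof -
    have t0: "t > 0" using pos t by simp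
    have x: "\<bar>- exp (- 2 * pi * t)\<bar> < 1" using t0 by simp
    have b: "\<bar>sigma_coeff k j\<bar> \<le> (1 + 9 / 8 * (1 / 2) ^ (k - 1)) * real j ^ k" for j
      using sigma_coeff_bounds[OF k, of j] zero_le_power[of "real j" k] by linarith
    have s0: "summable (\<lambda>j. sigma_coeff k j * (- exp (- 2 * pi * t)) ^ j)"
      by (rule summable_poly_bounded_powser[OF b x])
    have s1: "summable (\<lambda>j. real j * sigma_coeff k j * (- exp (- 2 * pi * t)) ^ j)"
      by (rule powser_log_deriv(1)[where 'a = real])
         (rule summable_poly_bounded_powser[OF b], use x in simp_all)
    have "F1 t - q * F t = (\<Sum>j. real j * sigma_coeff k j * (- exp (- 2 * pi * t)) ^ j -
        q * (sigma_coeff k j * (- exp (- 2 * pi * t)) ^ j))"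
      unfolding F1_def F_def qsum_def suminf_mult[OF s0, symmetric]
      by (rule suminf_diff[OF s1 summable_mult[OF s0]])
    also have "\<dots> = qsum (\<lambda>j. (real j - q) * sigma_coeff k j) t"
      unfolding qsum_def by (simp only: left_diff_distrib mult.assoc)
    also have "\<dots> = (\<Sum>j. (-1) ^ j * (real j - real m - 1 / 20) * qterm k t j)"
      unfolding qsum_qterm by (simp only: q_def diff_diff_eq)
    finally show ?thesis
      using weighted_sum_q[OF m t] by (simp only:)
  qed
  have der: "\<exists>d. (g has_real_derivative d) (at t) \<and> d > 0"
    if t: "a \<le> t" "t \<le> b" for t
  proof -
    have t0: "t > 0" using pos t a by simp
    have "(g has_real_derivative (-1) ^ m * (exp (2 * pi * q * t) * (2 * pi * q) * F t +
        (- 2 * pi * F1 t) * exp (2 * pi * q * t))) (at t)"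
      unfolding g_def
      by (rule DERIV_cmult, rule DERIV_mult)
         (auto intro!: derivative_eq_intros simp: F_def F1_def qsum_sigma_deriv[OF k t0, simplified])
    moreover have "(-1) ^ m * (exp (2 * pi * q * t) * (2 * pi * q) * F t + (- 2 * pi * F1 t) * exp (2 * pi * q * t)) =
       2 * pi * exp (2 * pi * q * t) * ((-1) ^ (m + 1) * (F1 t - q * F t))"
      by (simp add: algebra_simps)
    moreover have "\<dots> > 0"
      by (rule mult_pos_pos[OF _ pos']) (use t a in auto)
    ultimately show ?thesis by metis
  qed
  have "g a < g b"
    by (rule DERIV_pos_imp_increasing[OF a(2)]) (use der in blast)
  then show False
    using z by (simp add: g_def F_def)
qed

section \<open>The derivative of the Eisenstein series on the line\<close>

lemma deriv_eisenstein_E: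
  assumes k: "k \<ge> 10" and z: "Im z > 0"
  shows "deriv (eisenstein_E k) z = - (of_real (2 * real k / bernoulli k) * (2 * of_real pi * \<i>)) *
     (\<Sum>n. of_real (sigma_coeff k n) * exp (2 * of_real pi * \<i> * z) ^ n)"
proof -
  define c :: "nat \<Rightarrow> complex" where "c = (\<lambda>n. of_nat (divisor_sigma (k - 1) n))"
  let ?q = "\<lambda>z. exp (2 * of_real pi * \<i> * z)"
  let ?C = "complex_of_real (2 * real k / bernoulli k)"
  have cb: "\<bar>real (divisor_sigma (k - 1) n)\<bar> \<le> (1 + 9 / 8 * (1 / 2) ^ (k - 1)) * real n ^ k" for n
  proof (cases "n = 0")
    case False
    then have "1 * real (divisor_sigma (k - 1) n) \<le> real n * real (divisor_sigma (k - 1) n)"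
      by (intro mult_right_mono) auto
    then show ?thesis
      using sigma_coeff_bounds(2)[OF k, of n] by (simp add: sigma_coeff_def)
  qed simp
  have sm: "summable (\<lambda>n. c n * x ^ n)" if "norm x < 1" for x
  proof (rule summable_norm_cancel)
    have "summable (\<lambda>n. real (divisor_sigma (k - 1) n) * norm x ^ n)"
      by (rule summable_poly_bounded_powser[OF cb]) (use that in simp)
    then show "summable (\<lambda>n. norm (c n * x ^ n))"
      by (simp add: c_def norm_mult norm_power)
  qed
  have eq: "eisenstein_E k w = 1 - ?C * (\<Sum>n. c n * ?q w ^ n)" if "Im w > 0" for w
  proof -
    have "c 0 = 0" by (simp add: c_def)
    then have "(\<Sum>n. c (Suc n) * ?q w ^ Suc n) = (\<Sum>n. c n * ?q w ^ n)"
      using suminf_split_head[OF sm[OF norm_cexp_2pi_i_less_1[OF that]]] by simp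
    then show ?thesis by (simp add: eisenstein_E_def c_def)
  qed
  obtain D where D: "((\<lambda>x. \<Sum>n. c n * x ^ n) has_field_derivative D) (at (?q z))"
    and qD: "?q z * D = (\<Sum>n. of_nat n * c n * ?q z ^ n)"
    using powser_log_deriv(2)[OF sm norm_cexp_2pi_i_less_1[OF z]] by blast
  have "(?q has_field_derivative ?q z * (2 * of_real pi * \<i>)) (at z)"
    by (auto intro!: derivative_eq_intros)
  from DERIV_cmult[OF DERIV_chain2[OF D this], of ?C]
  have "((\<lambda>w. 1 - ?C * (\<Sum>n. c n * ?q w ^ n)) has_field_derivative
      0 - ?C * (D * (?q z * (2 * of_real pi * \<i>)))) (at z)"
    by (intro DERIV_diff DERIV_const)
  also have "0 - ?C * (D * (?q z * (2 * of_real pi * \<i>))) = - (?C * (2 * of_real pi * \<i>)) * (?q z * D)"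
    by (simp add: mult_ac)
  finally have "((\<lambda>w. 1 - ?C * (\<Sum>n. c n * ?q w ^ n)) has_field_derivative
      - (?C * (2 * of_real pi * \<i>)) * (?q z * D)) (at z)" .
  then have "(eisenstein_E k has_field_derivative - (?C * (2 * of_real pi * \<i>)) * (?q z * D)) (at z)"
    by (rule has_field_derivative_transform_within_open[OF _ open_halfspace_Im_gt[of 0]])
       (use z eq in auto)
  moreover have "of_nat n * c n = complex_of_real (sigma_coeff k n)" for n
    by (simp add: c_def sigma_coeff_def)
  ultimately show ?thesis
    unfolding qD by (simp only: DERIV_imp_deriv)
qed

lemma deriv_eisenstein_E_eq_0_iff:
  assumes k: "k \<ge> 10" "even k" and t: "t > 0"
  shows "deriv (eisenstein_E k) (1 / 2 + \<i> * of_real t) = 0 \<longleftrightarrow> qsum (sigma_coeff k) t = 0"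
proof -
  define x where "x = - exp (- 2 * pi * t)"
  have "exp (2 * of_real pi * \<i> * (1 / 2 + \<i> * of_real t)) = of_real x"
    by (simp add: x_def exp_eq_polar complex_eq_iff Re_exp Im_exp algebra_simps)
  then have "deriv (eisenstein_E k) (1 / 2 + \<i> * of_real t) =
      - (of_real (2 * real k / bernoulli k) * (2 * of_real pi * \<i>)) *
      (\<Sum>n. complex_of_real (sigma_coeff k n * x ^ n))"
    using deriv_eisenstein_E[OF k(1), of "1 / 2 + \<i> * of_real t"] t by simp
  moreover have "(\<Sum>n. complex_of_real (sigma_coeff k n * x ^ n)) = of_real (qsum (sigma_coeff k) t)"
  proof -
    have "summable (\<lambda>n. sigma_coeff k n * x ^ n)"
    proof (rule summable_poly_bounded_powser)
      show "\<bar>sigma_coeff k n\<bar> \<le> (1 + 9 / 8 * (1 / 2) ^ (k - 1)) * real n ^ k" for n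
        using sigma_coeff_bounds(2)[OF k(1), of n] by simp
      show "\<bar>x\<bar> < 1" using t by (simp add: x_def)
    qed
    then show ?thesis
      unfolding qsum_def x_def[symmetric] by (rule suminf_of_real[symmetric])
  qed
  moreover have "bernoulli k \<noteq> 0"
  proof -
    obtain j where "k = 2 * j" using k(2) by (elim evenE)
    then show ?thesis using bernoulli_even_sign[of j] k(1) by auto
  qed
  ultimately show ?thesis using k(1) by simp
qed

section \<open>Polar coordinates on the line\<close>

lemma cot_less_cot_iff:
  assumes "0 < x" "x < pi / 2" "0 < y" "y < pi / 2"
  shows "cot x < cot y \<longleftrightarrow> y < (x :: real)"
proof -
  have "0 < tan x" "0 < tan y"
    using assms by (auto intro: tan_gt_zero)
  then have "cot x < cot y \<longleftrightarrow> tan y < tan x"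
    unfolding cot_altdef by (simp add: inverse_less_iff_less)
  also have "\<dots> \<longleftrightarrow> y < x"
    using assms by (intro tan_mono_lt_eq) auto
  finally show ?thesis .
qed

text \<open>The point w of angle \<open>-\<phi>\<close> has imaginary part -1/2, so its modulus r is
  \<open>1 / (2 * sin \<phi>)\<close>; hence r decreases as \<open>\<phi>\<close> grows.\<close>

lemma half_cot_polar:
  assumes "sin \<phi> > 0"
  shows "inverse (Complex (1 / 2 * cot \<phi>) (- 1 / 2) ^ n) = of_real ((2 * sin \<phi>) ^ n) * cis (real n * \<phi>)"
    and "(1 / 2 * cot \<phi>)\<^sup>2 + 1 / 4 = (1 / (2 * sin \<phi>))\<^sup>2"
proof -
  have "Complex (1 / 2 * cot \<phi>) (- 1 / 2) = inverse (of_real (2 * sin \<phi>) * cis \<phi>)"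
  proof -
    have "inverse (of_real (2 * sin \<phi>) * cis \<phi>) = of_real (1 / (2 * sin \<phi>)) * cis (- \<phi>)"
      by (simp add: cis_inverse[symmetric] inverse_eq_divide)
    then show ?thesis
      using assms by (simp add: complex_eq_iff cot_def)
  qed
  moreover have "inverse (inverse (a * b) ^ n) = a ^ n * b ^ n" for a b :: complex
    by (simp only: power_inverse inverse_inverse_eq power_mult_distrib)
  ultimately show "inverse (Complex (1 / 2 * cot \<phi>) (- 1 / 2) ^ n) = of_real ((2 * sin \<phi>) ^ n) * cis (real n * \<phi>)"
    by (simp only: Complex.DeMoivre of_real_power)
  have "(sin \<phi>)\<^sup>2 + (cos \<phi>)\<^sup>2 = 1" by simp
  then show "(1 / 2 * cot \<phi>)\<^sup>2 + 1 / 4 = (1 / (2 * sin \<phi>))\<^sup>2"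
    using assms by (simp add: cot_def power_divide power_mult_distrib field_simps)
qed

lemma half_cot_cases:
  fixes t :: real
  assumes "t > 0"
  obtains \<phi> where "0 < \<phi>" "\<phi> < pi / 2" "t = 1 / 2 * cot \<phi>"
proof
  show "0 < arctan (1 / (2 * t))" using assms by simp
  show "arctan (1 / (2 * t)) < pi / 2" by (rule arctan_ubound)
  show "t = 1 / 2 * cot (arctan (1 / (2 * t)))"
    using assms by (simp add: cot_altdef tan_arctan)
qed

text \<open>Here the threshold \<open>11 * m^2\<close> meets the constant 3.4, which amounts to
  \<open>(sin \<phi>)^2 \<ge> 0.85 / n\<close>. From \<open>n \<le> 11 * m^2\<close> and
  \<open>pi^2 / 11 > 0.897\<close> one gets \<open>\<phi>^2 \<ge> 0.897 / n\<close>. The sine is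
  estimated at the smaller angle y, where y^2 is at most 0.082 and the cubic loss is below 1.4
  percent.\<close>

lemma node_sin_bound:
  assumes m: "1 \<le> m" "6 * m \<le> k" "k \<ge> 10" "k + 1 \<le> 11 * m\<^sup>2"
  shows "34 / 10 * (1 / (2 * sin (real m * pi / real (k + 1))))\<^sup>2 \<le> real (k + 1)"
proof -
  define n where "n = real (k + 1)"
  define y where "y = sqrt (897 / 1000 / n)"
  define \<phi> where "\<phi> = real m * pi / n"
  have n: "n \<ge> 11" using m by (simp add: n_def)
  have y2: "y\<^sup>2 = 897 / 1000 / n" and y0: "y > 0"
    using n by (simp_all add: y_def)
  have "n \<le> 11 * (real m)\<^sup>2"
    using of_nat_mono[OF m(4), where 'a = real] by (simp add: n_def)
  moreover have "897 / 1000 * 11 \<le> pi * pi"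
  proof -
    have "(3.1415 :: real) * 3.1415 \<le> pi * pi"
      using pi_approx by (intro mult_mono) auto
    then show ?thesis by simp
  qed
  ultimately have "n * (897 / 1000 * 11) \<le> 11 * (real m)\<^sup>2 * (pi * pi)"
    by (rule mult_mono) simp_all
  also have "\<dots> = 11 * (real m * pi)\<^sup>2"
    by (simp add: power2_eq_square)
  finally have "897 / 1000 * n \<le> (real m * pi)\<^sup>2"
    by linarith
  then have "897 / 1000 * n / n\<^sup>2 \<le> (real m * pi)\<^sup>2 / n\<^sup>2"
    by (rule divide_right_mono) simp
  then have "y\<^sup>2 \<le> \<phi>\<^sup>2"
    unfolding y2 \<phi>_def power_divide using n by (simp add: power2_eq_square)
  then have y\<phi>: "y \<le> \<phi>"
    by (rule power2_le_imp_le) (use n in \<open>simp add: \<phi>_def\<close>)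
  have "6 * real m \<le> n"
    using of_nat_mono[OF m(2), where 'a = real] by (simp add: n_def)
  then have "real m / n \<le> 1 / 6"
    using n by (simp add: pos_divide_le_eq)
  then have "real m / n * pi \<le> 1 / 6 * pi"
    by (rule mult_right_mono) simp
  then have \<phi>: "\<phi> \<le> pi / 6"
    by (simp add: \<phi>_def)
  have ysmall: "y\<^sup>2 \<le> 82 / 1000"
    unfolding y2 using n by (simp add: divide_simps)
  have "\<bar>sin y - (\<Sum>m<3. sin_coeff m * y ^ m)\<bar> \<le> inverse (fact 3) * \<bar>y\<bar> ^ 3"
    by (rule Maclaurin_sin_bound)
  moreover have "(\<Sum>m<3. sin_coeff m * y ^ m) = y"
    by (simp add: eval_nat_numeral sin_coeff_Suc cos_coeff_Suc)
  moreover have "inverse (fact 3) * \<bar>y\<bar> ^ 3 = y * (y\<^sup>2 / 6)"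
    using y0 by (simp add: fact_numeral power2_eq_square power3_eq_cube)
  moreover have "y * (y\<^sup>2 / 6) \<le> y * (137 / 10000)"
    using y0 ysmall by (intro mult_left_mono) auto
  ultimately have "y * (9863 / 10000) \<le> sin y"
    by linarith
  also have "sin y \<le> sin \<phi>"
    using y\<phi> \<phi> y0 by (intro sin_monotone_2pi_le) auto
  finally have s: "y * (9863 / 10000) \<le> sin \<phi>" .
  have "85 / 100 / n \<le> 897 / 1000 * (9863 / 10000)\<^sup>2 / n"
    using n by (intro divide_right_mono) (simp_all add: power2_eq_square)
  also have "\<dots> = (y * (9863 / 10000))\<^sup>2"
    unfolding power_mult_distrib y2 by simp
  also have "\<dots> \<le> (sin \<phi>)\<^sup>2"
    by (rule power_mono[OF s]) (use y0 in simp)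
  finally have "85 / 100 \<le> (sin \<phi>)\<^sup>2 * n"
    using n by (simp only: pos_divide_le_eq)
  moreover have "0 < (sin \<phi>)\<^sup>2"
    using y0 by (intro zero_less_power less_le_trans[OF _ s]) simp
  ultimately have "0 < 4 * (sin \<phi>)\<^sup>2" "34 / 10 \<le> 4 * ((sin \<phi>)\<^sup>2 * n)"
    by linarith+
  then have "34 / 10 / (4 * (sin \<phi>)\<^sup>2) \<le> n"
    by (simp only: pos_divide_le_eq mult_ac)
  then have "34 / 10 * (1 / (2 * sin \<phi>))\<^sup>2 \<le> n"
    by (simp add: power_divide power_mult_distrib)
  then show ?thesis by (simp only: \<phi>_def n_def)
qed

lemma sqrt3_half_eq_cot: "sqrt 3 / 2 = 1 / 2 * cot (pi / 6)"
  by (simp add: cot_def sin_30 cos_30)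

lemma DERIV_Im_inverse_power:
  fixes t :: real and n :: nat
  defines "w \<equiv> Complex t (- 1 / 2)"
  assumes n: "n \<ge> 1" and t: "t > 0"
  shows "((\<lambda>t. Im (inverse (Complex t (- 1 / 2) ^ n))) has_real_derivative
     - (real n * Im (inverse (w ^ n) / w))) (at t)"
proof -
  have w: "w \<noteq> 0" using t by (auto simp: w_def complex_eq_iff)
  have C: "Complex s (- 1 / 2) = of_real s - \<i> / 2" for s
    by (simp add: complex_eq_iff)
  have "((\<lambda>z. inverse ((z - \<i> / 2) ^ n)) has_field_derivative
      - (of_nat n * (inverse (w ^ n) / w))) (at (of_real t))"
  proof -
    have "((\<lambda>z. inverse ((z - \<i> / 2) ^ n)) has_field_derivative
       - (inverse (w ^ n) * (of_nat n * w ^ (n - Suc 0)) * inverse (w ^ n))) (at (of_real t))"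
      using w unfolding w_def C by (auto intro!: derivative_eq_intros)
    moreover have "inverse (w ^ n) * (of_nat n * w ^ (n - Suc 0)) * inverse (w ^ n) = of_nat n * (inverse (w ^ n) / w)"
      using n w by (cases n) (simp_all add: field_simps)
    ultimately show ?thesis by simp
  qed
  then have "((\<lambda>s. inverse ((of_real s - \<i> / 2) ^ n)) has_vector_derivative
      - (of_nat n * (inverse (w ^ n) / w))) (at t)"
    by (rule has_vector_derivative_real_field)
  then have "((\<lambda>s. Im (inverse ((of_real s - \<i> / 2) ^ n))) has_vector_derivative
      Im (- (of_nat n * (inverse (w ^ n) / w)))) (at t)"
    by (rule bounded_linear.has_vector_derivative[OF bounded_linear_Im])
  moreover have "Im (- (of_nat n * x)) = - (real n * Im x)" for x
    by simp
  ultimately show ?thesis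
    unfolding C has_real_derivative_iff_has_vector_derivative by (simp only:)
qed

section \<open>Signs and separation of the zeros\<close>

lemma node_angle:
  assumes "1 \<le> m" "6 * m \<le> k"
  shows "0 < real m * pi / real (k + 1)" "real m * pi / real (k + 1) < pi / 6"
    "real m * pi / real (k + 1) < pi / 2"
proof -
  show "0 < real m * pi / real (k + 1)" using assms by simp
  have "6 * real m < real (k + 1)"
    using of_nat_mono[OF assms(2), where 'a = real] by simp
  then have "real m / real (k + 1) < 1 / 6"
    by (simp add: pos_divide_less_eq)
  then have "real m / real (k + 1) * pi < 1 / 6 * pi"
    by (rule mult_strict_right_mono) simp
  then show less: "real m * pi / real (k + 1) < pi / 6"
    by simp
  show "real m * pi / real (k + 1) < pi / 2"
    by (rule less_trans[OF less]) simp
qed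

lemma cot_height_gt:
  assumes "1 \<le> m" "6 * m \<le> k"
  shows "sqrt 3 / 2 < cot_height k m"
  unfolding sqrt3_half_eq_cot cot_height_def
  by (intro mult_strict_left_mono cot_less_cot_iff[THEN iffD2] node_angle assms) simp_all

lemma cot_height_strict_antimono:
  assumes "1 \<le> m" "6 * (m + 1) \<le> k"
  shows "cot_height k (m + 1) < cot_height k m"
proof -
  have "real m * pi / real (k + 1) < real (m + 1) * pi / real (k + 1)"
    by (intro divide_strict_right_mono mult_strict_right_mono) auto
  moreover have "6 * m \<le> k" "1 \<le> m + 1" using assms by auto
  ultimately show ?thesis
    unfolding cot_height_def
    by (intro mult_strict_left_mono cot_less_cot_iff[THEN iffD2] node_angle assms) simp_all
qed

lemma lattice_regime_half_cot:
  assumes k: "k \<ge> 10" "even k" and phi: "0 < \<phi>" "\<phi> \<le> pi / 6"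
    and r: "34 / 10 * (1 / (2 * sin \<phi>))\<^sup>2 \<le> real (k + 1)"
  shows "lattice_regime k (k div 2) (1 / 2 * cot \<phi>) (1 / (2 * sin \<phi>))"
proof
  have s: "sin \<phi> > 0" by (rule sin_gt_zero) (use phi in auto)
  show "k = 2 * (k div 2)" "5 \<le> k div 2" using k by auto
  have "\<phi> < pi / 2"
    by (rule le_less_trans[OF phi(2)]) simp
  then have "\<not> cot \<phi> < cot (pi / 6)"
    using phi cot_less_cot_iff[of \<phi> "pi / 6"] by simp
  then show "sqrt 3 / 2 \<le> 1 / 2 * cot \<phi>"
    unfolding sqrt3_half_eq_cot by simp
  show "0 < 1 / (2 * sin \<phi>)" using s by simp
  show "(1 / (2 * sin \<phi>))\<^sup>2 = (1 / 2 * cot \<phi>)\<^sup>2 + 1 / 4"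
    using half_cot_polar(2)[OF s] by simp
  show "34 / 10 * (1 / (2 * sin \<phi>))\<^sup>2 \<le> real (k + 1)" by (rule r)
qed

text \<open>Multiplication by \<open>r ^ (k + 1)\<close> turns \<open>Re W\<close> into the cosine,
  so any angle whose cosine exceeds 7/10 in modulus decides the sign. This serves both the nodes and
  the corner \<open>sqrt 3 / 2\<close>.\<close>

lemma lattice_sign:
  assumes k: "k \<ge> 10" "even k" and phi: "0 < \<phi>" "\<phi> \<le> pi / 6"
    and r: "34 / 10 * (1 / (2 * sin \<phi>))\<^sup>2 \<le> real (k + 1)"
    and s: "\<bar>s\<bar> = 1" "s * cos (real (k + 1) * \<phi>) > 7 / 10"
  shows "s * qsum (sigma_coeff k) (1 / 2 * cot \<phi>) > 0"
proof -
  interpret lattice_regime k "k div 2" "1 / 2 * cot \<phi>" "1 / (2 * sin \<phi>)"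
    "Complex (1 / 2 * cot \<phi>) (- 1 / 2)" "inverse (Complex (1 / 2 * cot \<phi>) (- 1 / 2) ^ (k + 1))"
    "\<lambda>j. inverse (Complex (1 / 2 * cot \<phi>) (- (real j + 1 / 2)) ^ (k + 1))"
    "\<lambda>j. Complex (1 / 2 * cot \<phi>) (- (real j + 1 / 2))"
    by (rule lattice_regime_half_cot[OF k phi r])
  have s0: "sin \<phi> > 0" by (rule sin_gt_zero) (use phi in auto)
  define R where "R = (1 / (2 * sin \<phi>)) ^ (k + 1)"
  define F where "F = lattice_scale k * qsum (sigma_coeff k) (1 / 2 * cot \<phi>)"
  define c where "c = cos (real (k + 1) * \<phi>)"
  have R: "R > 0" using s0 by (simp add: R_def)
  have "R * (2 * sin \<phi>) ^ (k + 1) = 1"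
    unfolding R_def power_mult_distrib[symmetric] using s0 by simp
  moreover have "Re (inverse (Complex (1 / 2 * cot \<phi>) (- 1 / 2) ^ (k + 1))) = (2 * sin \<phi>) ^ (k + 1) * c"
    unfolding half_cot_polar(1)[OF s0] by (simp add: c_def)
  ultimately have RW: "R * Re (inverse (Complex (1 / 2 * cot \<phi>) (- 1 / 2) ^ (k + 1))) = c"
    by (simp only: mult.assoc[symmetric] mult_1_left)
  have "R * \<bar>F - Re (inverse (Complex (1 / 2 * cot \<phi>) (- 1 / 2) ^ (k + 1)))\<bar> \<le> 7 / 10"
    using value_bound by (simp only: R_def F_def)
  also have "R * \<bar>F - Re (inverse (Complex (1 / 2 * cot \<phi>) (- 1 / 2) ^ (k + 1)))\<bar> = \<bar>R * F - c\<bar>"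
    using R unfolding RW[symmetric] by (simp only: abs_mult abs_of_pos flip: right_diff_distrib)
  also have "\<dots> = \<bar>s * (R * F) - s * c\<bar>"
    using s(1) by (simp only: abs_mult mult_1_left flip: right_diff_distrib)
  finally have "s * (R * F) > 0"
    using s(2) unfolding c_def by linarith
  then have "0 < (R * lattice_scale k) * (s * qsum (sigma_coeff k) (1 / 2 * cot \<phi>))"
    by (simp add: F_def mult_ac)
  then show ?thesis
    by (rule zero_less_mult_pos) (use R lattice_scale_pos[of k] in simp)
qed

lemma sin_nonzero_between_multiples:
  assumes "real m * pi < x" "x < real (m + 1) * pi"
  shows "sin x \<noteq> 0"
proof -
  have "sin (x - real m * pi) > 0"
    by (rule sin_gt_zero) (use assms in \<open>auto simp: algebra_simps\<close>)
  moreover have "sin x = (-1) ^ m * sin (x - real m * pi)"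
    by (simp add: sin_diff cos_npi sin_npi flip: power_add mult.assoc)
  ultimately show ?thesis by auto
qed

text \<open>Two zeros of F would be two zeros of the strictly increasing quotient of F by
  \<open>Im W\<close>. The free lower end \<open>lo\<close> covers the intervals between nodes as
  well as the last one, which stops at \<open>sqrt 3 / 2\<close>.\<close>

lemma no_two_zeros_lattice:
  assumes k: "k \<ge> 10" "even k" and m: "1 \<le> m" "6 * m \<le> k" "k + 1 \<le> 11 * m\<^sup>2"
    and lo: "sqrt 3 / 2 \<le> lo" "cot_height k (m + 1) \<le> lo"
    and ab: "lo < a" "a < b" "b < cot_height k m"
    and z: "qsum (sigma_coeff k) a = 0" "qsum (sigma_coeff k) b = 0"
  shows False
proof -
  define B where "B = (\<lambda>t. Im (inverse (Complex t (- 1 / 2) ^ (k + 1))))"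
  define F where "F = qsum (sigma_coeff k)"
  define g where "g = (\<lambda>t. F t / B t)"
  have der: "\<exists>d. (g has_real_derivative d) (at t) \<and> d > 0"
    if t: "a \<le> t" "t \<le> b" for t
  proof -
    have tlo: "lo < t" "t < cot_height k m" using t ab by auto
    have t0: "t > 0"
      using tlo lo by (meson less_le_trans less_trans half_gt_zero real_sqrt_gt_zero zero_less_numeral le_less_trans)
    obtain \<phi> where phi: "0 < \<phi>" "\<phi> < pi / 2" "t = 1 / 2 * cot \<phi>"
      by (rule half_cot_cases[OF t0])
    note ang = node_angle[OF m(1,2)]
    have phi6: "\<phi> < pi / 6"
      using tlo(1) lo(1) cot_less_cot_iff[of "pi / 6" \<phi>] phi unfolding sqrt3_half_eq_cot by simp
    have phim: "real m * pi / real (k + 1) < \<phi>"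
      using tlo(2) cot_less_cot_iff[OF phi(1,2) ang(1,3)]
      unfolding cot_height_def phi(3) by simp
    have phim1: "\<phi> < real (m + 1) * pi / real (k + 1)"
    proof (cases "real (m + 1) * pi / real (k + 1) < pi / 2")
      case True
      then show ?thesis
        using tlo(1) lo(2) cot_less_cot_iff[of "real (m + 1) * pi / real (k + 1)" \<phi>] phi
        unfolding cot_height_def by simp
    next
      case False
      then show ?thesis using phi(2) by linarith
    qed
    have s0: "sin \<phi> > 0" by (rule sin_gt_zero) (use phi in auto)
    \<comment> \<open>The modulus r is largest at the upper end of the interval, so the bound on r
      at the node carries over to every point below it.\<close>
    have "sin (real m * pi / real (k + 1)) \<le> sin \<phi>"
      using phim phi(2) ang(1) pi_gt_zero by (intro sin_monotone_2pi_le) linarith+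
    moreover have "sin (real m * pi / real (k + 1)) > 0"
      using ang(1,2) pi_gt_zero by (intro sin_gt_zero) linarith+
    ultimately have "1 / (2 * sin \<phi>) \<le> 1 / (2 * sin (real m * pi / real (k + 1)))"
      by (intro divide_left_mono) auto
    then have "(1 / (2 * sin \<phi>))\<^sup>2 \<le> (1 / (2 * sin (real m * pi / real (k + 1))))\<^sup>2"
      using s0 by (intro power_mono) auto
    then have r: "34 / 10 * (1 / (2 * sin \<phi>))\<^sup>2 \<le> real (k + 1)"
      using node_sin_bound[OF m(1,2) k(1) m(3)] by linarith
    have reg: "lattice_regime k (k div 2) t (1 / (2 * sin \<phi>))"
      unfolding phi(3) using phi6 by (intro lattice_regime_half_cot k phi r) simp
    \<comment> \<open>Strictly between consecutive multiples of pi the sine does not vanish, so the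
      division by \<open>Im W\<close> is legitimate.\<close>
    have "real m * pi < real (k + 1) * \<phi>" "real (k + 1) * \<phi> < real (m + 1) * pi"
      using phim phim1 by (simp_all add: pos_divide_less_eq pos_less_divide_eq mult.commute del: of_nat_add of_nat_Suc)
    then have "sin (real (k + 1) * \<phi>) \<noteq> 0"
      by (rule sin_nonzero_between_multiples)
    then have Bt: "B t \<noteq> 0"
      unfolding B_def phi(3) half_cot_polar(1)[OF s0] using s0 by simp
    define F1 where "F1 = qsum (\<lambda>j. real j * sigma_coeff k j) t"
    define B1 where "B1 = real (k + 1) * Im (inverse (Complex t (- 1 / 2) ^ (k + 1)) / Complex t (- 1 / 2))"
    have "lattice_scale k * (- 2 * pi * F1) * B t + lattice_scale k * F t * B1 > 0"
      using lattice_regime.wronskian_pos[OF reg] by (simp only: B_def F_def F1_def B1_def)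
    then have "0 < lattice_scale k * ((- 2 * pi * F1) * B t + F t * B1)"
      by (simp only: distrib_left mult.assoc)
    then have w: "0 < (- 2 * pi * F1) * B t - F t * (- B1)"
      using lattice_scale_pos[of k] by (simp add: zero_less_mult_iff)
    have "(B has_real_derivative - B1) (at t)"
      unfolding B_def B1_def by (rule DERIV_Im_inverse_power) (use t0 in auto)
    with qsum_sigma_deriv[OF k(1) t0]
    have "(g has_real_derivative ((- 2 * pi * F1) * B t - F t * (- B1)) / (B t * B t)) (at t)"
      unfolding g_def F_def F1_def by (rule DERIV_divide) (rule Bt)
    moreover have "((- 2 * pi * F1) * B t - F t * (- B1)) / (B t * B t) > 0"
      using w Bt by (intro divide_pos_pos) (auto simp: zero_less_mult_iff)
    ultimately show ?thesis by blast
  qed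
  have "g a < g b"
    by (rule DERIV_pos_imp_increasing[OF ab(2)]) (use der in blast)
  then show False
    using z by (simp add: g_def F_def)
qed

lemma sign_at_node:
  assumes k: "k \<ge> 10" "even k" and m: "1 \<le> m" "6 * m \<le> k"
  shows "(-1) ^ m * qsum (sigma_coeff k) (cot_height k m) > 0"
proof (cases "k + 1 \<le> 11 * m\<^sup>2")
  case True
  let ?\<phi> = "real m * pi / real (k + 1)"
  have "real (k + 1) * ?\<phi> = real m * pi" by simp
  then have "(-1) ^ m * cos (real (k + 1) * ?\<phi>) = 1"
    by (simp only: cos_npi) (simp flip: power_add)
  then show ?thesis
    unfolding cot_height_def
    using node_angle[OF m] node_sin_bound[OF m k(1) True]
    by (intro lattice_sign k) (auto simp: power_abs)
next
  case False
  then have "11 * m\<^sup>2 \<le> k" by simp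
  moreover have "1 \<le> m\<^sup>2" using m by simp
  ultimately have "11 \<le> k" by linarith
  moreover have "k \<noteq> 11" using k(2) by auto
  ultimately show ?thesis
    using \<open>11 * m\<^sup>2 \<le> k\<close> m by (intro sign_at_node_series) auto
qed

text \<open>For this residue \<open>(k+1) * pi / 6\<close> is \<open>M * pi + 5 * pi / 6\<close>, so
  the cosine is \<open>sqrt 3 / 2\<close> in modulus and opposite in sign to its value at the M-th
  node. That change of sign produces the zero on the last segment.\<close>

lemma sign_at_rho:
  assumes k: "k = 6 * M + 4" and M: "M \<ge> 1"
  shows "(-1) ^ (M + 1) * qsum (sigma_coeff k) (sqrt 3 / 2) > 0"
proof -
  have "real (k + 1) * (pi / 6) = real M * pi + 5 * pi / 6"
    by (simp add: k algebra_simps)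
  moreover have "cos (5 * pi / 6) = - (sqrt 3 / 2)"
  proof -
    have "5 * pi / 6 = pi - pi / 6" by simp
    then show ?thesis by (simp only: cos_pi_minus cos_30)
  qed
  ultimately have "cos (real (k + 1) * (pi / 6)) = (-1) ^ M * - (sqrt 3 / 2)"
    by (simp only: cos_add cos_npi sin_npi)
  then have c: "(-1) ^ (M + 1) * cos (real (k + 1) * (pi / 6)) = sqrt 3 / 2"
    by (simp flip: mult.assoc power_add)
  have "sqrt 3 > 7 / 5"
    by (rule real_less_rsqrt) (simp add: power2_eq_square)
  then have "(-1) ^ (M + 1) * qsum (sigma_coeff k) (1 / 2 * cot (pi / 6)) > 0"
    using k M c by (intro lattice_sign) (auto simp: power_abs sin_30)
  then show ?thesis by (simp only: sqrt3_half_eq_cot)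
qed

lemma unique_zero_on_segment:
  assumes k: "k \<ge> 10" "even k" and a: "0 < a" "a < b"
    and sgn: "s * qsum (sigma_coeff k) a < 0" "s * qsum (sigma_coeff k) b > 0"
    and inj: "\<And>x y. a < x \<Longrightarrow> x < y \<Longrightarrow> y < b \<Longrightarrow> qsum (sigma_coeff k) x = 0 \<Longrightarrow>
        qsum (sigma_coeff k) y = 0 \<Longrightarrow> False"
  shows "\<exists>!z. z \<in> segment_re_half a b \<and> deriv (eisenstein_E k) z = 0"
proof -
  have cont: "isCont (\<lambda>t. s * qsum (sigma_coeff k) t) t" if "a \<le> t" for t
    using qsum_sigma_deriv[OF k(1), of t] that a by (intro continuous_intros DERIV_isCont) auto
  have "\<exists>t\<ge>a. t \<le> b \<and> s * qsum (sigma_coeff k) t = 0"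
    by (rule IVT) (use a sgn cont in auto)
  then obtain t where t: "a \<le> t" "t \<le> b" "s * qsum (sigma_coeff k) t = 0" by blast
  have s: "s \<noteq> 0" using sgn by auto
  have ta: "a < t" "t < b" "qsum (sigma_coeff k) t = 0"
    using t sgn s by (auto simp: order_le_less)
  have iff: "deriv (eisenstein_E k) (1 / 2 + \<i> * of_real x) = 0 \<longleftrightarrow> qsum (sigma_coeff k) x = 0"
    if "a < x" for x
    by (rule deriv_eisenstein_E_eq_0_iff[OF k]) (use that a in simp)
  show ?thesis
  proof (rule ex1I)
    show "1 / 2 + \<i> * of_real t \<in> segment_re_half a b \<and> deriv (eisenstein_E k) (1 / 2 + \<i> * of_real t) = 0"
      using ta iff[of t] by (auto simp: segment_re_half_def)
  next
    fix z assume z: "z \<in> segment_re_half a b \<and> deriv (eisenstein_E k) z = 0"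
    then obtain x where x: "z = 1 / 2 + \<i> * of_real x" "a < x" "x < b"
      by (auto simp: segment_re_half_def)
    then have "qsum (sigma_coeff k) x = 0" using z iff by simp
    then have "x = t"
      using inj[of x t] inj[of t x] ta x by (cases x t rule: linorder_cases) auto
    then show "z = 1 / 2 + \<i> * of_real t" using x by simp
  qed
qed

theorem theorem3:
  fixes k M :: nat
  assumes "k \<ge> 4" and "even k" and "M = k div 6"
  shows "(\<forall>m. 1 \<le> m \<and> m + 1 \<le> M \<longrightarrow> cot_height k m > cot_height k (m + 1))
       \<and> (M \<ge> 1 \<longrightarrow> cot_height k M > sqrt 3 / 2)
       \<and> (\<forall>m. 1 \<le> m \<and> m + 1 \<le> M \<longrightarrow>
            (\<exists>!z. z \<in> segment_re_half (cot_height k (m + 1)) (cot_height k m)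
                \<and> deriv (eisenstein_E k) z = 0))
       \<and> (k mod 6 = 4 \<and> k \<noteq> 4 \<longrightarrow>
            (\<exists>!z. z \<in> segment_re_half (sqrt 3 / 2) (cot_height k M)
                \<and> deriv (eisenstein_E k) z = 0))"
proof (intro conjI allI impI; (elim conjE)?)
  fix m assume m: "1 \<le> m" "m + 1 \<le> M"
  then have m6: "6 * m \<le> k" "6 * (m + 1) \<le> k" using assms(3) by auto
  then have k: "k \<ge> 10" using m by simp
  show mono: "cot_height k m > cot_height k (m + 1)"
    using cot_height_strict_antimono m(1) m6(2) .
  have lo: "sqrt 3 / 2 < cot_height k (m + 1)"
    by (rule cot_height_gt) (use m6 in auto)
  have lo0: "0 < cot_height k (m + 1)"
    by (rule less_trans[OF _ lo]) simp
  show "\<exists>!z. z \<in> segment_re_half (cot_height k (m + 1)) (cot_height k m) \<and> deriv (eisenstein_E k) z = 0"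
  proof (rule unique_zero_on_segment[OF k assms(2) lo0 mono])
    show "(-1) ^ m * qsum (sigma_coeff k) (cot_height k m) > 0"
      by (rule sign_at_node[OF k assms(2) m(1) m6(1)])
    show "(-1) ^ m * qsum (sigma_coeff k) (cot_height k (m + 1)) < 0"
      using sign_at_node[OF k assms(2) _ m6(2)] by simp
  next
    fix x y
    assume xy: "cot_height k (m + 1) < x" "x < y" "y < cot_height k m"
      "qsum (sigma_coeff k) x = 0" "qsum (sigma_coeff k) y = 0"
    show False
    proof (cases "k + 1 \<le> 11 * m\<^sup>2")
      case True
      show False
        by (rule no_two_zeros_lattice[OF k assms(2) m(1) m6(1) True less_imp_le[OF lo] order_refl xy])
    next
      case False
      then have "11 * m\<^sup>2 \<le> k" by simp
      moreover have "12 \<le> k" using m6 m by simp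
      ultimately show False
        using no_two_zeros_series[OF m(1) _ _ lo0 xy] by blast
    qed
  qed
next
  assume "M \<ge> 1"
  then show "cot_height k M > sqrt 3 / 2"
    by (intro cot_height_gt) (use assms(3) in auto)
next
  assume k4: "k mod 6 = 4" "k \<noteq> 4"
  then have kM: "k = 6 * M + 4" and M: "M \<ge> 1" and k: "k \<ge> 10"
    using assms(1,3) by presburger+
  have M6: "6 * M \<le> k" using kM by simp
  \<comment> \<open>The last segment always lies in the lattice region, as 6M + 5 is at most 11 M^2
    for M at least 1.\<close>
  have lat: "k + 1 \<le> 11 * M\<^sup>2"
  proof -
    have "M * 1 \<le> M * M" using M by (intro mult_left_mono) auto
    then show ?thesis using M unfolding kM power2_eq_square by linarith
  qed
  \<comment> \<open>Since 6 * (M + 1) exceeds k + 1 = 6M + 5, the next node would lie below the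
    corner; the segment thus stays between two consecutive zeros of \<open>Im W\<close>.\<close>
  have above: "cot_height k (M + 1) \<le> sqrt 3 / 2"
  proof -
    have "pi / 6 < real (M + 1) * pi / real (k + 1)"
      by (simp add: kM field_simps)
    moreover have "real (M + 1) * pi / real (k + 1) < pi / 2"
      by (simp add: kM field_simps add_pos_nonneg)
    ultimately have "cot (real (M + 1) * pi / real (k + 1)) < cot (pi / 6)"
      by (subst cot_less_cot_iff) auto
    then show ?thesis
      unfolding sqrt3_half_eq_cot cot_height_def by simp
  qed
  show "\<exists>!z. z \<in> segment_re_half (sqrt 3 / 2) (cot_height k M) \<and> deriv (eisenstein_E k) z = 0"
  proof (rule unique_zero_on_segment[OF k assms(2)])
    show "0 < sqrt 3 / 2" by simp
    show "sqrt 3 / 2 < cot_height k M"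
      by (rule cot_height_gt[OF M M6])
    show "(-1) ^ M * qsum (sigma_coeff k) (cot_height k M) > 0"
      by (rule sign_at_node[OF k assms(2) M M6])
    show "(-1) ^ M * qsum (sigma_coeff k) (sqrt 3 / 2) < 0"
      using sign_at_rho[OF kM M] by simp
  next
    fix x y
    assume xy: "sqrt 3 / 2 < x" "x < y" "y < cot_height k M"
      "qsum (sigma_coeff k) x = 0" "qsum (sigma_coeff k) y = 0"
    show False
      by (rule no_two_zeros_lattice[OF k assms(2) M M6 lat order_refl above xy])
  qed
qed

end
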